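(* Let $H,K\in M_n(\mathbb{C})$ be Hermitian and let $r>0$. Then for every real $t$ with $t\le 0$ or $t\ge 1$ and every unitarily invariant norm $|||\cdot|||$ on $M_n(\mathbb{C})$, $$\big|\big|\big|e^{(1-t)H+tK}\big|\big|\big|\le \big|\big|\big|\left(e^{rH}\#_t e^{rK}\right)^{1/r}\big|\big|\big|.$$
   Context: For positive definite $X,Y\in M_n(\mathbb{C})$ and any $t\in\mathbb{R}$, the weighted geometric mean is $X\#_tY:=X^{1/2}(X^{-1/2}YX^{-1/2})^tX^{1/2}$, where real powers of positive definite matrices are defined by functional calculus; $X\#_tY$ is positive definite. A norm $|||\cdot|||$ on $M_n(\mathbb{C})$ is unitarily invariant if $|||UAV|||=|||A|||$ for all $A$ and all unitaries $U,V$. *)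

theory Defs
  imports Complex_Main "Jordan_Normal_Form.Matrix"
begin

definition adj :: "complex mat \<Rightarrow> complex mat" where
  "adj A = mat (dim_col A) (dim_row A) (\<lambda>(i,j). cnj (A $$ (j,i)))"

definition hermitian :: "nat \<Rightarrow> complex mat \<Rightarrow> bool" where
  "hermitian n A \<longleftrightarrow> A \<in> carrier_mat n n \<and> adj A = A"

definition unitary :: "nat \<Rightarrow> complex mat \<Rightarrow> bool" where
  "unitary n U \<longleftrightarrow> U \<in> carrier_mat n n \<and> U * adj U = 1\<^sub>m n \<and> adj U * U = 1\<^sub>m n"

definition rdiag :: "nat \<Rightarrow> (nat \<Rightarrow> real) \<Rightarrow> complex mat" where
  "rdiag n d = mat n n (\<lambda>(i,j). if i = j then complex_of_real (d i) else 0)"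

text \<open>Functional calculus for Hermitian matrices: if A = U diag(d) U^* with U unitary,
  then f(A) = U diag(f o d) U^*. (Independent of the chosen diagonalisation.)\<close>
definition mat_fun :: "(real \<Rightarrow> real) \<Rightarrow> complex mat \<Rightarrow> complex mat" where
  "mat_fun f A = (SOME B. \<exists>U d. unitary (dim_row A) U \<and>
       A = U * rdiag (dim_row A) d * adj U \<and> B = U * rdiag (dim_row A) (f \<circ> d) * adj U)"

definition mexp :: "complex mat \<Rightarrow> complex mat" where
  "mexp A = mat_fun exp A"

definition mpow :: "complex mat \<Rightarrow> real \<Rightarrow> complex mat" where
  "mpow X p = mat_fun (\<lambda>x. x powr p) X"

definition gmean :: "complex mat \<Rightarrow> real \<Rightarrow> complex mat \<Rightarrow> complex mat" where
  "gmean X t Y = mpow X (1/2) * mpow (mpow X (-1/2) * Y * mpow X (-1/2)) t * mpow X (1/2)"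

definition unitarily_invariant_norm :: "nat \<Rightarrow> (complex mat \<Rightarrow> real) \<Rightarrow> bool" where
  "unitarily_invariant_norm n N \<longleftrightarrow>
     (\<forall>A \<in> carrier_mat n n. N A \<ge> 0 \<and> (N A = 0 \<longleftrightarrow> A = 0\<^sub>m n n)) \<and>
     (\<forall>A \<in> carrier_mat n n. \<forall>c. N (c \<cdot>\<^sub>m A) = cmod c * N A) \<and>
     (\<forall>A \<in> carrier_mat n n. \<forall>B \<in> carrier_mat n n. N (A + B) \<le> N A + N B) \<and>
     (\<forall>A \<in> carrier_mat n n. \<forall>U V. unitary n U \<longrightarrow> unitary n V \<longrightarrow> N (U * A * V) = N A)"

end

(*
  For k <= n let pi(M) be the product of the k largest eigenvalues of M. Since X #_t Y = Y #_{1-t} X,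
  let t >= 1. Put A = e^{rH}, B = e^{rK}, C = A #_t B and s = 1/t, so that B = A #_s C. Araki's inequality
  pi(X^s Y^s X^s) <= pi(X Y X)^s for 0 <= s <= 1, applied to A^{1/2} and A^{-1/2} C A^{-1/2}, gives
  pi(A^{(s-1)/2} B A^{(s-1)/2}) <= pi(C)^s. Applied once more it gives, for 0 <= x <= 1,
  pi(A^{x(s-1)/2} B^x A^{x(s-1)/2}) <= pi(C)^{sx}, with equality at x = 0. Comparing derivatives at x = 0,
  the sum of the k largest eigenvalues of (1-t)H + tK is at most log pi(C) / r. This weak majorization
  passes to the norms of the exponentials by Ky Fan dominance.

  No exterior powers are needed: pi(Z^* Z) <= c is expressed as
  det((ZW)^* (ZW)) <= c det(W^* W) for all n x k matrices W, which is visibly multiplicative in Z.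
*)

theory Submission
  imports Defs "Jordan_Normal_Form.Spectral_Radius"
begin

section \<open>Adjoints, diagonal matrices and functional calculus\<close>

text \<open>The detour through B = \<open>A #_s C\<close> exists because Araki's inequality controls
  only exponents in [0, 1], so for t >= 1 the power t must be undone instead of applied. With Y =
  A^{-1/2} B A^{-1/2} and C = A^{1/2} Y^t A^{1/2}, the power s of Y^t is Y again, and the factors
  A^{s/2} around Y leave B between two copies of A^{(s-1)/2}. The exponent s - 1 = (1-t)/t,
  multiplied by t, is the weight of H.

  Two obstacles shape the proof. A product of the largest eigenvalues is awkward to differentiate
  where eigenvalues meet. So the comparison at x = 0 fixes W, with top eigenvectors of (1-t)H + tK
  as columns: the inequality holds for each W, and its Gram determinant is smooth in x. Araki's
  inequality must hold for all real exponents; the good exponents in [0, 1] form a closed set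
  containing 0 and 1 and stable under midpoints, and the midpoint step compares eigenvalues of a
  product with its singular values.

  The dominance step is carried out on diagonal matrices: weak majorization is split into transfers
  between two coordinates, and each transfer is an average of diagonal matrices of equal
  norm.\<close>

declare assoc_mult_mat [simp del] mult_carrier_mat [simp del]

text \<open>The usual carrier rules for products mention the inner dimension, which simp would have
  to guess. This equivalence and \<open>mat_assoc\<close> ask only for dimensions that can be read
  off the factors.\<close>

lemma mult_carrier_iff [simp]: "A * B \<in> carrier_mat n m \<longleftrightarrow> dim_row A = n \<and> dim_col B = m"
  unfolding carrier_mat_def by auto

lemma mat_assoc:
  "dim_col A = dim_row B \<Longrightarrow> dim_col B = dim_row C \<Longrightarrow> A * B * C = A * (B * (C :: 'a :: semiring_0 mat))"
  by (rule assoc_mult_mat[of _ "dim_row A" "dim_col A" _ "dim_col B" _ "dim_col C"]) auto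

lemma index_mult_sum:
  assumes "A \<in> carrier_mat n m" "B \<in> carrier_mat m l" "i < n" "j < l"
  shows "(A * B) $$ (i,j) = (\<Sum>k<m. A $$ (i,k) * B $$ (k,j))"
  using assms by (auto simp: scalar_prod_def atLeast0LessThan intro!: sum.cong)

lemma adj_dim [simp]: "dim_row (adj A) = dim_col A" "dim_col (adj A) = dim_row A"
  by (auto simp: adj_def)

lemma adj_carrier [simp]: "adj A \<in> carrier_mat n m \<longleftrightarrow> A \<in> carrier_mat m n"
  unfolding carrier_mat_def by auto

lemma adj_index [simp]: "i < dim_col A \<Longrightarrow> j < dim_row A \<Longrightarrow> adj A $$ (i,j) = cnj (A $$ (j,i))"
  by (simp add: adj_def)

lemma adj_adj [simp]: "adj (adj A) = A"
  by (rule eq_matI) auto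

lemma adj_one [simp]: "adj (1\<^sub>m n) = 1\<^sub>m n"
  by (rule eq_matI) auto

lemma adj_mult: "dim_col A = dim_row B \<Longrightarrow> adj (A * B) = adj B * adj A"
  by (rule eq_matI) (auto simp: scalar_prod_def intro!: sum.cong)

lemma adj_add: "dim_row A = dim_row B \<Longrightarrow> dim_col A = dim_col B \<Longrightarrow> adj (A + B) = adj A + adj B"
  by (rule eq_matI) auto

lemma adj_smult: "adj (c \<cdot>\<^sub>m A) = cnj c \<cdot>\<^sub>m adj A"
  by (rule eq_matI) auto

lemma rdiag_carrier [simp]: "rdiag n d \<in> carrier_mat n m \<longleftrightarrow> m = n"
  by (auto simp: rdiag_def)

lemma rdiag_dim [simp]: "dim_row (rdiag n d) = n" "dim_col (rdiag n d) = n"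
  by (auto simp: rdiag_def)

lemma rdiag_index [simp]:
  "i < n \<Longrightarrow> j < n \<Longrightarrow> rdiag n d $$ (i,j) = (if i = j then of_real (d i) else 0)"
  by (auto simp: rdiag_def)

lemma adj_rdiag [simp]: "adj (rdiag n d) = rdiag n d"
  by (rule eq_matI) auto

lemma rdiag_one: "rdiag n (\<lambda>_. 1) = 1\<^sub>m n"
  by (rule eq_matI) auto

lemma rdiag_cong: "(\<And>i. i < n \<Longrightarrow> d i = e i) \<Longrightarrow> rdiag n d = rdiag n e"
  by (rule eq_matI) auto

lemma rdiag_mult_index:
  assumes "A \<in> carrier_mat n m" "i < n" "j < m"
  shows "(rdiag n d * A) $$ (i,j) = of_real (d i) * A $$ (i,j)"
  using assms by (subst index_mult_sum[where m = n]) (auto simp: if_distrib[of "\<lambda>x. x * _"] cong: if_cong)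

lemma mult_rdiag_index:
  assumes "A \<in> carrier_mat m n" "i < m" "j < n"
  shows "(A * rdiag n d) $$ (i,j) = A $$ (i,j) * of_real (d j)"
  using assms by (subst index_mult_sum[where m = n]) (auto simp: if_distrib[of "\<lambda>x. _ * x"] cong: if_cong)

lemma rdiag_mult: "rdiag n d * rdiag n e = rdiag n (\<lambda>i. d i * e i)"
  by (rule eq_matI) (auto simp: rdiag_mult_index[where m = n] simp del: index_mult_mat(1))

lemma rdiag_add: "rdiag n d + rdiag n e = rdiag n (\<lambda>i. d i + e i)"
  by (rule eq_matI) auto

lemma rdiag_smult: "complex_of_real c \<cdot>\<^sub>m rdiag n d = rdiag n (\<lambda>i. c * d i)"
  by (rule eq_matI) auto

lemma det_rdiag: "det (rdiag n d) = of_real (\<Prod>i<n. d i)"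
proof -
  have "det (rdiag n d) = prod_list (diag_mat (rdiag n d))"
    by (rule det_upper_triangular[of _ n]) auto
  also have "diag_mat (rdiag n d) = map (\<lambda>i. of_real (d i)) [0..<n]"
    by (auto simp: diag_mat_def)
  also have "prod_list \<dots> = (\<Prod>i<n. of_real (d i))"
    by (simp add: prod.distinct_set_conv_list[symmetric] atLeast0LessThan)
  finally show ?thesis by simp
qed

lemma unitaryD:
  assumes "unitary n U"
  shows "U \<in> carrier_mat n n" "dim_row U = n" "dim_col U = n" "U * adj U = 1\<^sub>m n" "adj U * U = 1\<^sub>m n"
  using assms by (auto simp: unitary_def)

lemma unitaryI: "U \<in> carrier_mat n n \<Longrightarrow> adj U * U = 1\<^sub>m n \<Longrightarrow> unitary n U"
  using mat_mult_left_right_inverse[of "adj U" n U] by (auto simp: unitary_def)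

lemma unitary_adj: "unitary n U \<Longrightarrow> unitary n (adj U)"
  by (auto simp: unitary_def)

lemma unitary_one [simp]: "unitary n (1\<^sub>m n)"
  by (auto simp: unitary_def)

text \<open>For right-nested products, in which \<open>A * B\<close> itself is not a
  subterm.\<close>

lemma cancel_mult:
  fixes A :: "'a :: semiring_1 mat"
  assumes "A * B = 1\<^sub>m n" "dim_col A = dim_row B" "dim_row C = n" "dim_col B = n"
  shows "A * (B * C) = C"
  using assms by (simp add: mat_assoc[symmetric])

lemma unitary_mult:
  assumes "unitary n U" "unitary n V"
  shows "unitary n (U * V)"
proof (rule unitaryI)
  note [simp] = unitaryD[OF assms(1)] unitaryD[OF assms(2)]
  show "adj (U * V) * (U * V) = 1\<^sub>m n"
    by (simp add: adj_mult mat_assoc cancel_mult[of "adj U" U n])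
qed (use assms in \<open>auto simp: unitary_def\<close>)

text \<open>Hermitian matrices are carried around as explicit spectral data, so that the choice
  operator in \<open>mat_fun\<close> is dealt with once, in \<open>mat_fun_spec\<close>.\<close>

definition spec_mat :: "nat \<Rightarrow> complex mat \<Rightarrow> (nat \<Rightarrow> real) \<Rightarrow> complex mat" where
  "spec_mat n U d = U * rdiag n d * adj U"

definition decr_below :: "nat \<Rightarrow> (nat \<Rightarrow> real) \<Rightarrow> bool" where
  "decr_below n d \<longleftrightarrow> (\<forall>i j. i \<le> j \<longrightarrow> j < n \<longrightarrow> d j \<le> d i)"

lemma spec_carrier [simp]: "U \<in> carrier_mat n n \<Longrightarrow> spec_mat n U d \<in> carrier_mat n n"
  unfolding spec_mat_def by simp

lemma spec_dim [simp]: "dim_row (spec_mat n U d) = dim_row U" "dim_col (spec_mat n U d) = dim_row U"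
  by (auto simp: spec_mat_def)

lemma spec_index:
  assumes "U \<in> carrier_mat n n" "i < n" "j < n"
  shows "spec_mat n U d $$ (i,j) = (\<Sum>k<n. U $$ (i,k) * of_real (d k) * cnj (U $$ (j,k)))"
  unfolding spec_mat_def using assms
  by (subst index_mult_sum[where m = n and n = n and l = n]) (auto simp: mult_rdiag_index[of _ n] simp del: index_mult_mat(1) intro!: sum.cong)

lemma spec_cong: "(\<And>i. i < n \<Longrightarrow> d i = e i) \<Longrightarrow> spec_mat n U d = spec_mat n U e"
  unfolding spec_mat_def by (simp cong: rdiag_cong)

lemma adj_spec [simp]: "U \<in> carrier_mat n n \<Longrightarrow> adj (spec_mat n U d) = spec_mat n U d"
  unfolding spec_mat_def by (simp add: adj_mult mat_assoc)

lemma spec_mult: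
  assumes "unitary n U"
  shows "spec_mat n U d * spec_mat n U e = spec_mat n U (\<lambda>i. d i * e i)"
proof -
  note [simp] = unitaryD[OF assms]
  show ?thesis
    unfolding spec_mat_def
    by (simp add: mat_assoc cancel_mult[of "adj U" U n])
      (simp add: mat_assoc[symmetric] rdiag_mult)
qed

lemma spec_one: "unitary n U \<Longrightarrow> spec_mat n U (\<lambda>_. 1) = 1\<^sub>m n"
  unfolding spec_mat_def by (simp add: rdiag_one unitaryD)

lemma spec_smult:
  assumes "U \<in> carrier_mat n n"
  shows "complex_of_real c \<cdot>\<^sub>m spec_mat n U d = spec_mat n U (\<lambda>i. c * d i)"
  using assms by (intro eq_matI) (auto simp: spec_index sum_distrib_left mult_ac)

lemma det_spec:
  assumes "unitary n U"
  shows "det (spec_mat n U d) = of_real (\<Prod>i<n. d i)"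
proof -
  note [simp] = unitaryD[OF assms]
  have "det (spec_mat n U d) = det (rdiag n d) * (det U * det (adj U))"
    unfolding spec_mat_def
    using det_mult[of "U * rdiag n d" n "adj U"] det_mult[of U n "rdiag n d"] by simp
  also have "det U * det (adj U) = 1"
    using det_mult[of U n "adj U"] by simp
  finally show ?thesis by (simp add: det_rdiag)
qed

lemma spec_unitary:
  assumes "unitary n U" "unitary n V"
  shows "spec_mat n (U * V) d = U * spec_mat n V d * adj U"
  using unitaryD[OF assms(1)] unitaryD[OF assms(2)]
  unfolding spec_mat_def by (simp add: adj_mult mat_assoc)

text \<open>Two diagonalisations are linked by \<open>W = adj V * U\<close>, which intertwines the
  diagonal matrices of \<open>d\<close> and \<open>e\<close>. Entrywise,
  \<open>W $$ (i,j) = 0\<close> or \<open>d j = e i\<close>, and this persists after applying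
  \<open>f\<close>; hence all candidates for the chosen matrix agree.\<close>

lemma mat_fun_spec:
  assumes U: "unitary n U"
  shows "mat_fun f (spec_mat n U d) = spec_mat n U (f \<circ> d)"
proof -
  note [simp] = unitaryD[OF U]
  have *: "B = spec_mat n U (f \<circ> d)"
    if V: "unitary n V" and eq: "spec_mat n U d = spec_mat n V e" and B: "B = spec_mat n V (f \<circ> e)" for B V e
  proof -
    note [simp] = unitaryD[OF V]
    define W where "W = adj V * U"
    have [simp]: "W \<in> carrier_mat n n" "dim_row W = n" "dim_col W = n" by (simp_all add: W_def)
    have UVW: "U = V * W" unfolding W_def by (simp add: cancel_mult[of V "adj V" n])
    have "adj V * (spec_mat n U d * U) = adj V * (spec_mat n V e * U)" using eq by simp
    hence WD: "W * rdiag n d = rdiag n e * W"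
      unfolding spec_mat_def W_def
      by (simp add: mat_assoc cancel_mult[of "adj V" V n])
    have "W * rdiag n (f \<circ> d) = rdiag n (f \<circ> e) * W"
    proof (rule eq_matI)
      fix i j assume ij: "i < dim_row (rdiag n (f \<circ> e) * W)" "j < dim_col (rdiag n (f \<circ> e) * W)"
      hence ij: "i < n" "j < n" by auto
      have "(W * rdiag n d) $$ (i,j) = (rdiag n e * W) $$ (i,j)" using WD by simp
      hence "W $$ (i,j) = 0 \<or> d j = e i"
        using ij by (simp add: mult_rdiag_index[of _ n] rdiag_mult_index[where m = n] del: index_mult_mat(1))
      thus "(W * rdiag n (f \<circ> d)) $$ (i,j) = (rdiag n (f \<circ> e) * W) $$ (i,j)"
        using ij by (auto simp add: mult_rdiag_index[of _ n] rdiag_mult_index[where m = n] simp del: index_mult_mat(1))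
    qed auto
    hence "V * (W * rdiag n (f \<circ> d)) * adj U = V * (rdiag n (f \<circ> e) * W) * adj U" by simp
    also have "V * (W * rdiag n (f \<circ> d)) * adj U = spec_mat n U (f \<circ> d)"
      unfolding spec_mat_def by (simp add: UVW mat_assoc)
    also have "V * (rdiag n (f \<circ> e) * W) * adj U = spec_mat n V (f \<circ> e)"
      unfolding spec_mat_def W_def by (simp add: mat_assoc)
    finally show ?thesis using B by simp
  qed
  show ?thesis
    unfolding mat_fun_def
  proof (rule some_equality)
    show "\<exists>V e. unitary (dim_row (spec_mat n U d)) V \<and> spec_mat n U d = V * rdiag (dim_row (spec_mat n U d)) e * adj V \<and>
        spec_mat n U (f \<circ> d) = V * rdiag (dim_row (spec_mat n U d)) (f \<circ> e) * adj V"
      using U by (intro exI[of _ U] exI[of _ d]) (simp add: spec_mat_def)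
  next
    fix B
    assume "\<exists>V e. unitary (dim_row (spec_mat n U d)) V \<and> spec_mat n U d = V * rdiag (dim_row (spec_mat n U d)) e * adj V \<and>
        B = V * rdiag (dim_row (spec_mat n U d)) (f \<circ> e) * adj V"
    then obtain V e where "unitary n V" "spec_mat n U d = spec_mat n V e" "B = spec_mat n V (f \<circ> e)"
      unfolding spec_mat_def by auto
    thus "B = spec_mat n U (f \<circ> d)" by (rule *)
  qed
qed

section \<open>Sorting eigenvalues by permutation matrices\<close>

lemma decr_belowD: "decr_below n d \<Longrightarrow> i \<le> j \<Longrightarrow> j < n \<Longrightarrow> d j \<le> d i"
  by (auto simp: decr_below_def)

definition perm_mat :: "nat \<Rightarrow> (nat \<Rightarrow> nat) \<Rightarrow> complex mat" where
  "perm_mat n p = mat n n (\<lambda>(i,j). if i = p j then 1 else 0)"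

lemma perm_mat_conj:
  assumes p: "bij_betw p {..<n} {..<n}"
  shows "unitary n (perm_mat n p)" "spec_mat n (perm_mat n p) (d \<circ> p) = rdiag n d"
proof -
  have c[simp]: "perm_mat n p \<in> carrier_mat n n" "dim_row (perm_mat n p) = n" "dim_col (perm_mat n p) = n"
    by (simp_all add: perm_mat_def)
  have p1: "p i < n" if "i < n" for i using p that by (auto simp: bij_betw_def)
  have *: "spec_mat n (perm_mat n p) (e \<circ> p) = rdiag n e" for e
  proof (rule eq_matI)
    fix i j assume "i < dim_row (rdiag n e)" "j < dim_col (rdiag n e)"
    hence ij: "i < n" "j < n" by auto
    have "spec_mat n (perm_mat n p) (e \<circ> p) $$ (i,j) = (\<Sum>k<n. if i = p k \<and> j = p k then of_real (e (p k)) else 0)"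
      using ij by (subst spec_index[OF c(1)]) (auto simp: perm_mat_def intro!: sum.cong)
    also have "\<dots> = (\<Sum>k<n. if i = k \<and> j = k then of_real (e k) else 0)"
      by (rule sum.reindex_bij_betw[OF p])
    also have "\<dots> = (\<Sum>k<n. if k = i then (if i = j then of_real (e i) else 0) else 0)"
      by (rule sum.cong) auto
    finally show "spec_mat n (perm_mat n p) (e \<circ> p) $$ (i,j) = rdiag n e $$ (i,j)" using ij by simp
  qed auto
  show "unitary n (perm_mat n p)"
  proof -
    \<comment> \<open>Unitarity is the instance of \<open>*\<close> with all eigenvalues 1.\<close>
    have "adj (perm_mat n p) * perm_mat n p = 1\<^sub>m n"
      using *[of "\<lambda>_. 1"] mat_mult_left_right_inverse[of "perm_mat n p" n "adj (perm_mat n p)"]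
      by (simp add: spec_mat_def rdiag_one comp_def)
    thus ?thesis by (intro unitaryI) auto
  qed
  show "spec_mat n (perm_mat n p) (d \<circ> p) = rdiag n d" by (rule *)
qed

lemma ex_decr_below_perm: "\<exists>p. bij_betw p {..<n} {..<n} \<and> decr_below n (d \<circ> p)" for d :: "nat \<Rightarrow> real"
proof -
  define xs where "xs = sort_key (\<lambda>i. - d i) [0..<n]"
  have len: "length xs = n" and set: "set xs = {..<n}" and dist: "distinct xs"
    by (auto simp: xs_def)
  have "sorted (map (\<lambda>i. - d i) xs)" by (simp add: xs_def)
  hence "decr_below n (d \<circ> (!) xs)"
    using len by (auto simp: decr_below_def sorted_iff_nth_mono)
  moreover have "bij_betw ((!) xs) {..<n} {..<n}"
    using len set dist by (intro bij_betw_nth) auto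
  ultimately show ?thesis by blast
qed

lemma sort_spec:
  assumes "unitary n U"
  shows "\<exists>V p. unitary n V \<and> bij_betw p {..<n} {..<n} \<and> decr_below n (d \<circ> p) \<and> spec_mat n U d = spec_mat n V (d \<circ> p)"
proof -
  obtain p where p: "bij_betw p {..<n} {..<n}" "decr_below n (d \<circ> p)" using ex_decr_below_perm by blast
  have "spec_mat n (U * perm_mat n p) (d \<circ> p) = spec_mat n U d"
    using assms perm_mat_conj[OF p(1)] by (subst spec_unitary) (auto simp: spec_mat_def)
  thus ?thesis using p perm_mat_conj(1)[OF p(1)] assms unitary_mult by metis
qed

section \<open>The spectral theorem\<close>

lemma norm_col:
  assumes "y \<in> carrier_mat n 1"
  shows "(adj y * y) $$ (0,0) = of_real (\<Sum>i<n. (cmod (y $$ (i,0)))\<^sup>2)"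
  using assms by (subst index_mult_sum[where m = n and n = 1 and l = 1])
    (auto simp: complex_norm_square mult.commute intro!: sum.cong simp del: of_real_power)

text \<open>The reflection along \<open>u = w - e_0\<close> exchanges the first unit vector
  \<open>e_0\<close> with a unit vector \<open>w\<close> whose entry \<open>w 0\<close> is real. The
  phase \<open>c\<close> makes that entry real and nonnegative.\<close>

lemma householder:
  fixes v :: "nat \<Rightarrow> complex"
  assumes n: "0 < n" and v: "(\<Sum>i<n. (cmod (v i))\<^sup>2) = 1"
  shows "\<exists>U c. unitary n U \<and> (\<forall>i<n. U $$ (i,0) = c * v i)"
proof -
  define c where "c = (if v 0 = 0 then 1 else cnj (v 0) / of_real (cmod (v 0)))"
  define w where "w = (\<lambda>i. c * v i)"
  define r where "r = cmod (v 0)"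
  have c1: "cmod c = 1" by (simp add: c_def norm_divide)
  have w0: "w 0 = of_real r"
    using complex_norm_square[of "v 0"] by (auto simp: w_def c_def r_def power2_eq_square field_simps)
  have sw: "(\<Sum>i<n. (cmod (w i))\<^sup>2) = 1"
    using v by (simp add: w_def norm_mult c1)
  define u where "u = (\<lambda>i. w i - (if i = 0 then 1 else 0))"
  \<comment> \<open>The squared length of \<open>u\<close>. If it vanishes, \<open>w\<close> is
    already the first unit vector and the identity serves.\<close>
  define s where "s = 2 - 2 * r"
  have su: "(\<Sum>k<n. u k * cnj (u k)) = of_real s"
  proof -
    have "u k * cnj (u k) = of_real ((cmod (w k))\<^sup>2) + (if k = 0 then 1 - 2 * of_real r else 0)" for k
      unfolding complex_norm_square by (auto simp: u_def w0 algebra_simps)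
    hence "(\<Sum>k<n. u k * cnj (u k)) = of_real (\<Sum>i<n. (cmod (w i))\<^sup>2) + (\<Sum>k<n. if k = 0 then 1 - 2 * of_real r else 0)"
      by (simp add: sum.distrib)
    thus ?thesis using n by (simp add: sw s_def del: of_real_sum)
  qed
  have "\<exists>U. unitary n U \<and> (\<forall>i<n. U $$ (i,0) = w i)"
  proof (cases "s = 0")
    case True
    have "of_real (\<Sum>k<n. (cmod (u k))\<^sup>2) = (of_real 0 :: complex)"
      using su True by (simp add: complex_norm_square del: of_real_power)
    hence "(\<Sum>k<n. (cmod (u k))\<^sup>2) = 0" by (simp only: of_real_eq_iff)
    hence "\<forall>k<n. u k = 0" by (subst (asm) sum_nonneg_eq_0_iff) auto
    thus ?thesis using n by (intro exI[of _ "1\<^sub>m n"]) (auto simp: u_def)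
  next
    case False
    define a where "a = complex_of_real (2 / s)"
    have as: "a * of_real s = 2" using False by (simp add: a_def)
    define U where "U = mat n n (\<lambda>(i,j). (if i = j then 1 else 0) - a * (u i * cnj (u j)))"
    have Uc: "U \<in> carrier_mat n n" "dim_row U = n" "dim_col U = n" by (simp_all add: U_def)
    have "adj U = U" by (rule eq_matI) (auto simp: U_def a_def)
    moreover have "U * U = 1\<^sub>m n"
    proof (rule eq_matI)
      fix i j assume "i < dim_row (1\<^sub>m n)" "j < dim_col (1\<^sub>m n)"
      hence ij: "i < n" "j < n" by auto
      have "(U * U) $$ (i,j) = (\<Sum>k<n. ((if i = k then 1 else 0) - a * (u i * cnj (u k))) * ((if k = j then 1 else 0) - a * (u k * cnj (u j))))"
        using ij Uc by (subst index_mult_sum[where m = n and n = n and l = n]) (auto simp: U_def)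
      also have "\<dots> = (\<Sum>k<n. (if k = i then (if i = j then 1 else 0) - a * (u i * cnj (u j)) else 0)
           + (if k = j then - a * (u i * cnj (u j)) else 0) + a * a * u i * cnj (u j) * (u k * cnj (u k)))"
        by (rule sum.cong) (auto simp: algebra_simps)
      also have "\<dots> = (if i = j then 1 else 0) - 2 * a * (u i * cnj (u j)) + a * a * u i * cnj (u j) * of_real s"
        using ij by (simp add: sum.distrib sum_distrib_left[symmetric] su)
      also have "\<dots> = (if i = j then 1 else 0) + a * u i * cnj (u j) * (a * of_real s - 2)"
        by (simp add: algebra_simps)
      finally show "(U * U) $$ (i,j) = 1\<^sub>m n $$ (i,j)" using ij as by simp
    qed (use Uc in auto)
    ultimately have "unitary n U" using Uc by (intro unitaryI) simp_all
    moreover have "U $$ (i,0) = w i" if "i < n" for i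
    proof -
      have "U $$ (i,0) = (if i = 0 then 1 else 0) - a * (u i * cnj (u 0))" using that n by (simp add: U_def)
      also have "a * (u i * cnj (u 0)) = u i * (a * (of_real r - 1))" by (simp add: u_def w0)
      also have "a * (of_real r - 1) = - 1"
      proof -
        have "2 * (a * (of_real r - 1)) = - (a * of_real s)" by (simp add: s_def algebra_simps)
        thus ?thesis by (simp add: as)
      qed
      finally show ?thesis by (simp add: u_def)
    qed
    ultimately show ?thesis by blast
  qed
  thus ?thesis unfolding w_def by blast
qed

text \<open>Deflation: a unitary whose first column is a normalised eigenvector turns
  \<open>A\<close> into \<open>B\<close> with first column (e, 0, ..., 0). Since \<open>B\<close> is
  Hermitian, its first row has the same shape and \<open>e\<close> is real, and the induction
  hypothesis diagonalises the remaining block.\<close>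

theorem spectral_theorem:
  "hermitian n A \<Longrightarrow> \<exists>U d. unitary n U \<and> A = spec_mat n U d"
proof (induction n arbitrary: A)
  case 0
  hence "A = spec_mat 0 (1\<^sub>m 0) (\<lambda>_. 0)" by (intro eq_matI) (auto simp: hermitian_def)
  thus ?case using unitary_one by blast
next
  case (Suc n)
  let ?n = "Suc n"
  have A: "A \<in> carrier_mat ?n ?n" "adj A = A" using Suc.prems by (auto simp: hermitian_def)
  note [simp] = carrier_matD[OF A(1)]
  obtain e v where ev: "eigenvector A v e"
    using spectrum_non_empty[OF A(1)] unfolding spectrum_def eigenvalue_def by auto
  hence v: "v \<in> carrier_vec ?n" "v \<noteq> 0\<^sub>v ?n" "A *\<^sub>v v = e \<cdot>\<^sub>v v"
    by (auto simp: eigenvector_def)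
  define q where "q = sqrt (\<Sum>i<?n. (cmod (v $ i))\<^sup>2)"
  have "\<exists>i<?n. v $ i \<noteq> 0" using v(1,2) by auto
  then obtain i0 where i0: "i0 < ?n" "v $ i0 \<noteq> 0" by blast
  have "(\<Sum>i<?n. (cmod (v $ i))\<^sup>2) > 0"
    by (rule sum_pos2[of _ i0]) (use i0 in auto)
  hence q: "q > 0" "q\<^sup>2 = (\<Sum>i<?n. (cmod (v $ i))\<^sup>2)" by (auto simp: q_def)
  have "(\<Sum>i<?n. (cmod (v $ i / of_real q))\<^sup>2) = (\<Sum>i<?n. (cmod (v $ i))\<^sup>2) / q\<^sup>2"
    by (simp add: norm_divide power_divide sum_divide_distrib del: sum.lessThan_Suc)
  also have "\<dots> = 1" unfolding q(2)[symmetric] using q(1) by simp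
  finally obtain U c where U: "unitary ?n U" and Uv: "\<And>i. i < ?n \<Longrightarrow> U $$ (i,0) = c * (v $ i / of_real q)"
    using householder[of ?n "\<lambda>i. v $ i / of_real q"] by blast
  note [simp] = unitaryD[OF U]
  define B where "B = adj U * (A * U)"
  have B: "B \<in> carrier_mat ?n ?n" "adj B = B"
    using A(2) by (simp_all add: B_def adj_mult mat_assoc)
  note [simp] = carrier_matD[OF B(1)]
  have AU: "(A * U) $$ (i,0) = e * U $$ (i,0)" if "i < ?n" for i
  proof -
    have "(A * U) $$ (i,0) = (\<Sum>k<?n. A $$ (i,k) * U $$ (k,0))"
      by (rule index_mult_sum[where n = ?n and l = ?n]) (use that A in auto)
    also have "\<dots> = (\<Sum>k<?n. A $$ (i,k) * v $ k) * (c / of_real q)"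
      unfolding sum_distrib_right by (rule sum.cong) (auto simp: Uv)
    also have "(\<Sum>k<?n. A $$ (i,k) * v $ k) = (A *\<^sub>v v) $ i"
      using that v(1) by (auto simp: scalar_prod_def atLeast0LessThan intro!: sum.cong)
    also have "(A *\<^sub>v v) $ i = e * v $ i" using that v by simp
    finally show ?thesis using that by (simp add: Uv)
  qed
  have Bi0: "B $$ (i,0) = (if i = 0 then e else 0)" if "i < ?n" for i
  proof -
    have "B $$ (i,0) = (\<Sum>k<?n. adj U $$ (i,k) * (A * U) $$ (k,0))"
      unfolding B_def by (rule index_mult_sum[where n = ?n and l = ?n]) (use that in auto)
    also have "\<dots> = e * (\<Sum>k<?n. adj U $$ (i,k) * U $$ (k,0))"
      unfolding sum_distrib_left by (rule sum.cong) (auto simp: AU simp del: index_mult_mat(1))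
    also have "(\<Sum>k<?n. adj U $$ (i,k) * U $$ (k,0)) = (adj U * U) $$ (i,0)"
      by (rule index_mult_sum[where n = ?n and l = ?n, symmetric]) (use that in auto)
    finally show ?thesis using that by simp
  qed
  have Bsym: "B $$ (i,j) = cnj (B $$ (j,i))" if "i < ?n" "j < ?n" for i j
    using that adj_index[of i B j] B by simp
  have e: "of_real (Re e) = e"
    using Bsym[of 0 0] Bi0[of 0] by (simp add: complex_eq_iff)
  have B0j: "B $$ (0,j) = (if j = 0 then e else 0)" if "j < ?n" for j
    using Bsym[of 0 j] Bi0[OF that] that e by (auto simp: complex_eq_iff)
  define C where "C = mat n n (\<lambda>(i,j). B $$ (Suc i, Suc j))"
  have "hermitian n C" unfolding hermitian_def
    by (auto simp: C_def Bsym[symmetric] intro!: eq_matI)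
  then obtain V d where V: "unitary n V" and C: "C = spec_mat n V d" using Suc.IH by blast
  note [simp] = unitaryD[OF V]
  define V' where "V' = mat ?n ?n (\<lambda>(i,j). if i = 0 \<and> j = 0 then 1 else if i = 0 \<or> j = 0 then 0 else V $$ (i - 1, j - 1))"
  define d' where "d' = case_nat (Re e) d"
  have V'c [simp]: "V' \<in> carrier_mat ?n ?n" "dim_row V' = ?n" "dim_col V' = ?n" by (simp_all add: V'_def)
  have V'i: "V' $$ (0,0) = 1" "\<And>i. i < n \<Longrightarrow> V' $$ (Suc i,0) = 0" "\<And>i. i < n \<Longrightarrow> V' $$ (0,Suc i) = 0"
    "\<And>i j. i < n \<Longrightarrow> j < n \<Longrightarrow> V' $$ (Suc i, Suc j) = V $$ (i,j)"
    by (simp_all add: V'_def)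
  have "adj V' * V' = 1\<^sub>m ?n"
  proof (rule eq_matI)
    fix i j assume "i < dim_row (1\<^sub>m ?n)" "j < dim_col (1\<^sub>m ?n)"
    hence ij: "i < ?n" "j < ?n" by auto
    have V1: "(\<Sum>k<n. cnj (V $$ (k,a)) * V $$ (k,b)) = (if a = b then 1 else 0)" if "a < n" "b < n" for a b
    proof -
      have "(adj V * V) $$ (a,b) = (\<Sum>k<n. adj V $$ (a,k) * V $$ (k,b))"
        by (rule index_mult_sum[where n = n and l = n]) (use that in auto)
      thus ?thesis using that by simp
    qed
    have "(adj V' * V') $$ (i,j) = (\<Sum>k<?n. adj V' $$ (i,k) * V' $$ (k,j))"
      by (rule index_mult_sum[where n = ?n and l = ?n]) (use ij in auto)
    also have "\<dots> = (\<Sum>k<?n. cnj (V' $$ (k,i)) * V' $$ (k,j))" using ij by (intro sum.cong) auto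
    also have "\<dots> = 1\<^sub>m ?n $$ (i,j)"
      using ij V1 by (cases i; cases j) (auto simp: sum.lessThan_Suc_shift V'i simp del: sum.lessThan_Suc)
    finally show "(adj V' * V') $$ (i,j) = 1\<^sub>m ?n $$ (i,j)" .
  qed auto
  hence V': "unitary ?n V'" by (intro unitaryI) auto
  have "B = spec_mat ?n V' d'"
  proof (rule eq_matI)
    fix i j assume "i < dim_row (spec_mat ?n V' d')" "j < dim_col (spec_mat ?n V' d')"
    hence ij: "i < ?n" "j < ?n" by auto
    have C': "B $$ (Suc a, Suc b) = (\<Sum>k<n. V $$ (a,k) * of_real (d k) * cnj (V $$ (b,k)))"
      if "a < n" "b < n" for a b
    proof -
      have "C $$ (a,b) = B $$ (Suc a, Suc b)" using that by (simp add: C_def)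
      thus ?thesis unfolding C using that by (simp add: spec_index)
    qed
    show "B $$ (i,j) = spec_mat ?n V' d' $$ (i,j)"
      using ij e by (subst spec_index[OF V'c(1)]; cases i; cases j)
        (auto simp: sum.lessThan_Suc_shift V'i Bi0 B0j C' d'_def simp del: sum.lessThan_Suc)
  qed auto
  hence "spec_mat ?n (U * V') d' = U * B * adj U"
    using U V' by (simp add: spec_unitary)
  also have "\<dots> = A"
    unfolding B_def by (simp add: mat_assoc cancel_mult[of U "adj U" ?n])
  finally show ?case using unitary_mult[OF U V'] by metis
qed

theorem spectral_theorem_sorted:
  assumes "hermitian n A"
  shows "\<exists>U d. unitary n U \<and> decr_below n d \<and> A = spec_mat n U d"
proof -
  obtain U d where "unitary n U" "A = spec_mat n U d" using spectral_theorem[OF assms] by blast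
  thus ?thesis using sort_spec[of n U d] by metis
qed

section \<open>Interlacing and products of the largest eigenvalues\<close>

lemma quad_rdiag:
  assumes "y \<in> carrier_mat n 1"
  shows "(adj y * (rdiag n d * y)) $$ (0,0) = of_real (\<Sum>i<n. d i * (cmod (y $$ (i,0)))\<^sup>2)"
proof -
  have "(adj y * (rdiag n d * y)) $$ (0,0) = (\<Sum>i<n. adj y $$ (0,i) * (rdiag n d * y) $$ (i,0))"
    by (rule index_mult_sum[where n = 1 and l = 1]) (use assms in auto)
  also have "\<dots> = (\<Sum>i<n. of_real (d i * (cmod (y $$ (i,0)))\<^sup>2))"
    using assms carrier_matD[OF assms]
    by (intro sum.cong)
      (auto simp: rdiag_mult_index[where m = 1] complex_norm_square simp del: index_mult_mat(1) of_real_power)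
  finally show ?thesis by simp
qed

lemma det_eq_0_iff_mat:
  fixes A :: "complex mat"
  assumes A: "A \<in> carrier_mat k k"
  shows "det A = 0 \<longleftrightarrow> (\<exists>x\<in>carrier_mat k 1. x \<noteq> 0\<^sub>m k 1 \<and> A * x = 0\<^sub>m k 1)"
proof
  assume "det A = 0"
  then obtain v where v: "v \<in> carrier_vec k" "v \<noteq> 0\<^sub>v k" "A *\<^sub>v v = 0\<^sub>v k"
    using det_0_iff_vec_prod_zero[OF A] by blast
  define x where "x = mat k 1 (\<lambda>(i,_). v $ i)"
  have x: "x \<in> carrier_mat k 1" "dim_row x = k" "dim_col x = 1" by (simp_all add: x_def)
  have "x \<noteq> 0\<^sub>m k 1"
  proof
    assume "x = 0\<^sub>m k 1"
    hence "x $$ (i,0) = 0" if "i < k" for i using that by simp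
    hence "v = 0\<^sub>v k" using v(1) by (intro eq_vecI) (auto simp: x_def)
    thus False using v by simp
  qed
  moreover have "A * x = 0\<^sub>m k 1"
  proof (rule eq_matI)
    fix i j assume "i < dim_row (0\<^sub>m k 1)" "j < dim_col (0\<^sub>m k 1)"
    hence ij: "i < k" "j = 0" by auto
    have "col x 0 = v" using v(1) by (intro eq_vecI) (auto simp: x_def)
    hence "(A * x) $$ (i,0) = (A *\<^sub>v v) $ i" using ij A x by simp
    thus "(A * x) $$ (i,j) = 0\<^sub>m k 1 $$ (i,j)" using ij v by simp
  qed (use A x in auto)
  ultimately show "\<exists>x\<in>carrier_mat k 1. x \<noteq> 0\<^sub>m k 1 \<and> A * x = 0\<^sub>m k 1" using x by blast
next
  assume "\<exists>x\<in>carrier_mat k 1. x \<noteq> 0\<^sub>m k 1 \<and> A * x = 0\<^sub>m k 1"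
  then obtain x where x: "x \<in> carrier_mat k 1" "x \<noteq> 0\<^sub>m k 1" "A * x = 0\<^sub>m k 1" by blast
  note [simp] = carrier_matD[OF A] carrier_matD[OF x(1)]
  have "col x 0 \<in> carrier_vec k" by (rule carrier_vecI) simp
  moreover have "col x 0 \<noteq> 0\<^sub>v k"
  proof
    assume *: "col x 0 = 0\<^sub>v k"
    have "x $$ (i,0) = 0" if "i < k" for i
      using arg_cong[OF *, of "\<lambda>v. v $ i"] that by simp
    hence "x = 0\<^sub>m k 1" by (intro eq_matI) auto
    thus False using x by simp
  qed
  moreover have "A *\<^sub>v col x 0 = 0\<^sub>v k"
  proof (rule eq_vecI)
    fix i assume "i < dim_vec (0\<^sub>v k)"
    thus "(A *\<^sub>v col x 0) $ i = 0\<^sub>v k $ i"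
      using arg_cong[OF x(3), of "\<lambda>B. B $$ (i,0)"] by simp
  qed simp
  ultimately show "det A = 0" using det_0_iff_vec_prod_zero[OF A] by blast
qed

text \<open>Courant-Fischer in coordinates: a nonzero \<open>x\<close> supported on the first
  \<open>i + 1\<close> coordinates, chosen so that \<open>Q * x\<close> vanishes on the first
  \<open>i\<close>, has a Rayleigh quotient that is at least \<open>m i\<close> and at most
  \<open>d i\<close>.\<close>

lemma interlacing:
  assumes Q: "Q \<in> carrier_mat n k" "adj Q * Q = 1\<^sub>m k" "adj Q * (rdiag n d * Q) = rdiag k m"
    and decr: "decr_below n d" "decr_below k m" and ik: "i < k" "k \<le> n"
  shows "m i \<le> d i"
proof -
  note [simp] = carrier_matD[OF Q(1)]
  \<comment> \<open>A padding row of zeros makes the \<open>i\<close> linear conditions on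
    \<open>i + 1\<close> unknowns a square singular system.\<close>
  define M where "M = mat (Suc i) (Suc i) (\<lambda>(a,b). if a < i then Q $$ (a,b) else 0)"
  have M: "M \<in> carrier_mat (Suc i) (Suc i)" by (simp add: M_def)
  have "det M = 0"
    unfolding det_def'[OF M]
  proof (rule sum.neutral, intro ballI)
    fix p assume "p \<in> {p. p permutes {0..<Suc i}}"
    hence "p i < Suc i" using permutes_in_image[of p "{0..<Suc i}" i] by auto
    hence "(\<Prod>a = 0..<Suc i. M $$ (a, p a)) = 0"
      by (intro prod_zero) (auto intro!: bexI[of _ i] simp: M_def)
    thus "signof p * (\<Prod>a = 0..<Suc i. M $$ (a, p a)) = 0" by simp
  qed
  then obtain x0 where x0: "x0 \<in> carrier_mat (Suc i) 1" "x0 \<noteq> 0\<^sub>m (Suc i) 1" "M * x0 = 0\<^sub>m (Suc i) 1"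
    using det_eq_0_iff_mat[OF M] by blast
  define x where "x = mat k 1 (\<lambda>(a,_). if a \<le> i then x0 $$ (a,0) else 0)"
  have x: "x \<in> carrier_mat k 1" and [simp]: "dim_row x = k" "dim_col x = 1" by (simp_all add: x_def)
  define y where "y = Q * x"
  have y: "y \<in> carrier_mat n 1" and [simp]: "dim_row y = n" "dim_col y = 1" by (simp_all add: y_def)
  have yj: "y $$ (j,0) = 0" if "j < i" for j
  proof -
    have "y $$ (j,0) = (\<Sum>l<k. Q $$ (j,l) * x $$ (l,0))"
      unfolding y_def by (rule index_mult_sum[where n = n and l = 1]) (use Q x that ik in auto)
    also have "\<dots> = (\<Sum>l<Suc i. M $$ (j,l) * x0 $$ (l,0))"
      using ik that by (intro sum.mono_neutral_cong_right) (auto simp: x_def M_def)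
    also have "\<dots> = (M * x0) $$ (j,0)"
      by (rule index_mult_sum[where n = "Suc i" and l = 1, symmetric]) (use M x0 that in auto)
    finally show ?thesis using x0 that by simp
  qed
  have "adj y * y = adj x * (adj Q * Q) * x"
    unfolding y_def by (simp add: adj_mult mat_assoc)
  also have "\<dots> = adj x * x" using Q(2) by simp
  finally have nrm: "(\<Sum>j<n. (cmod (y $$ (j,0)))\<^sup>2) = (\<Sum>l<k. (cmod (x $$ (l,0)))\<^sup>2)"
    using norm_col[OF x] norm_col[OF y] by (metis of_real_eq_iff)
  have "adj y * (rdiag n d * y) = adj x * (adj Q * (rdiag n d * Q)) * x"
    unfolding y_def by (simp add: adj_mult mat_assoc)
  also have "\<dots> = adj x * (rdiag k m * x)" unfolding Q(3) by (simp add: mat_assoc)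
  finally have quad: "(\<Sum>j<n. d j * (cmod (y $$ (j,0)))\<^sup>2) = (\<Sum>l<k. m l * (cmod (x $$ (l,0)))\<^sup>2)"
    using quad_rdiag[OF x, of m] quad_rdiag[OF y, of d] by (metis of_real_eq_iff)
  have "\<exists>l<Suc i. x0 $$ (l,0) \<noteq> 0"
  proof (rule ccontr)
    assume "\<not> ?thesis"
    hence "x0 = 0\<^sub>m (Suc i) 1" using x0(1) by (intro eq_matI) auto
    thus False using x0 by simp
  qed
  then obtain l where l: "l < Suc i" "x0 $$ (l,0) \<noteq> 0" by blast
  have pos: "(\<Sum>l<k. (cmod (x $$ (l,0)))\<^sup>2) > 0"
    by (rule sum_pos2[of _ l]) (use l ik in \<open>auto simp: x_def\<close>)
  have "m i * (\<Sum>l<k. (cmod (x $$ (l,0)))\<^sup>2) \<le> (\<Sum>l<k. m l * (cmod (x $$ (l,0)))\<^sup>2)"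
    unfolding sum_distrib_left
  proof (rule sum_mono)
    fix l assume "l \<in> {..<k}"
    thus "m i * (cmod (x $$ (l,0)))\<^sup>2 \<le> m l * (cmod (x $$ (l,0)))\<^sup>2"
      using decr_belowD[OF decr(2), of l i] ik
      by (cases "l \<le> i") (auto intro!: mult_right_mono simp: x_def)
  qed
  also have "\<dots> \<le> d i * (\<Sum>j<n. (cmod (y $$ (j,0)))\<^sup>2)"
    unfolding quad[symmetric] sum_distrib_left
  proof (rule sum_mono)
    fix j assume "j \<in> {..<n}"
    thus "d j * (cmod (y $$ (j,0)))\<^sup>2 \<le> d i * (cmod (y $$ (j,0)))\<^sup>2"
      using decr_belowD[OF decr(1), of i j] yj
      by (cases "j < i") (auto intro!: mult_right_mono)
  qed
  finally show ?thesis using pos unfolding nrm by simp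
qed

section \<open>Gram matrices and Gram determinants\<close>

lemma spec_conj:
  assumes "unitary n U"
  shows "adj U * (spec_mat n U d * U) = rdiag n d"
  using unitaryD[OF assms] unfolding spec_mat_def
  by (simp add: mat_assoc cancel_mult[of "adj U" U n])

lemma gram_hermitian: "Z \<in> carrier_mat n m \<Longrightarrow> hermitian m (adj Z * Z)"
  by (auto simp: hermitian_def adj_mult)

text \<open>Each eigenvalue is the squared length of a column of \<open>Z * U\<close>.\<close>

lemma gram_spec:
  assumes Z: "Z \<in> carrier_mat n m"
  shows "\<exists>U d. unitary m U \<and> decr_below m d \<and> (\<forall>i<m. 0 \<le> d i) \<and> adj Z * Z = spec_mat m U d"
proof -
  obtain U d where U: "unitary m U" and d: "decr_below m d" and eq: "adj Z * Z = spec_mat m U d"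
    using spectral_theorem_sorted[OF gram_hermitian[OF Z]] by blast
  note [simp] = unitaryD[OF U] carrier_matD[OF Z]
  have "0 \<le> d i" if i: "i < m" for i
  proof -
    have "adj (Z * U) * (Z * U) = adj U * (adj Z * Z * U)"
      by (simp add: adj_mult mat_assoc)
    also have "\<dots> = rdiag m d" unfolding eq using spec_conj[OF U] by simp
    finally have "of_real (d i) = (adj (Z * U) * (Z * U)) $$ (i,i)" using i by simp
    also have "\<dots> = (\<Sum>k<n. adj (Z * U) $$ (i,k) * (Z * U) $$ (k,i))"
      by (rule index_mult_sum[where n = m and l = m]) (use i in auto)
    also have "\<dots> = of_real (\<Sum>k<n. (cmod ((Z * U) $$ (k,i)))\<^sup>2)"
      unfolding of_real_sum using i
      by (intro sum.cong) (auto simp: complex_norm_square simp del: index_mult_mat(1) of_real_power)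
    finally have "d i = (\<Sum>k<n. (cmod ((Z * U) $$ (k,i)))\<^sup>2)" by (simp only: of_real_eq_iff)
    thus ?thesis by (simp add: sum_nonneg)
  qed
  thus ?thesis using U d eq by blast
qed

text \<open>The Gram determinant \<open>det (W\<^sup>* W)\<close> is real, so nothing is lost by taking the real part.\<close>

definition gdet :: "complex mat \<Rightarrow> real" where
  "gdet W = Re (det (adj W * W))"

definition gdet_bounded :: "nat \<Rightarrow> nat \<Rightarrow> real \<Rightarrow> complex mat \<Rightarrow> bool" where
  "gdet_bounded n k c Z \<longleftrightarrow> (\<forall>W\<in>carrier_mat n k. gdet (Z * W) \<le> c * gdet W)"

lemma det_gram: "det (adj W * W) = of_real (gdet W)" and gdet_nonneg: "0 \<le> gdet W"
proof -
  obtain U d where *: "unitary (dim_col W) U" "\<forall>i<dim_col W. 0 \<le> d i" "adj W * W = spec_mat (dim_col W) U d"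
    using gram_spec[of W "dim_row W" "dim_col W"] by auto
  thus "det (adj W * W) = of_real (gdet W)" "0 \<le> gdet W"
    unfolding gdet_def by (auto simp: det_spec simp del: of_real_prod intro!: prod_nonneg)
qed

lemma gdet_eq_prod:
  assumes "unitary k U" "adj W * W = spec_mat k U d"
  shows "gdet W = (\<Prod>i<k. d i)"
  unfolding gdet_def assms(2) det_spec[OF assms(1)] by (simp del: of_real_prod)

lemma gdet_eq_prod_rdiag: "adj W * W = rdiag k d \<Longrightarrow> gdet W = (\<Prod>i<k. d i)"
  by (simp add: gdet_def det_rdiag del: of_real_prod)

lemma gdet_mult_right:
  assumes "W \<in> carrier_mat n k" "T \<in> carrier_mat k k"
  shows "gdet (W * T) = (cmod (det T))\<^sup>2 * gdet W"
proof -
  note [simp] = carrier_matD[OF assms(1)] carrier_matD[OF assms(2)]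
  have dadj: "det (adj T) = cnj (det T)"
  proof -
    have "adj T = transpose_mat (map_mat cnj T)" by (rule eq_matI) auto
    moreover interpret comm_ring_hom cnj by unfold_locales auto
    have "det (map_mat cnj T) = cnj (det T)" by (rule hom_det)
    ultimately show ?thesis using det_transpose[of "map_mat cnj T" k] assms by simp
  qed
  have "adj (W * T) * (W * T) = adj T * (adj W * W) * T" by (simp add: adj_mult mat_assoc)
  hence "det (adj (W * T) * (W * T)) = det (adj T * (adj W * W)) * det T"
    using det_mult[of "adj T * (adj W * W)" k T] assms by simp
  also have "\<dots> = cnj (det T) * of_real (gdet W) * det T"
    using det_mult[of "adj T" k "adj W * W"] assms by (simp add: dadj det_gram)
  also have "\<dots> = of_real ((cmod (det T))\<^sup>2 * gdet W)"
    by (simp add: complex_norm_square del: of_real_power)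
  finally show ?thesis by (simp add: gdet_def del: of_real_mult of_real_power)
qed

text \<open>\<open>W\<close> and its Gram matrix have the same kernel, because the quadratic form of
  the Gram matrix at \<open>x\<close> is the squared length of \<open>W * x\<close>.\<close>

lemma gdet_eq_0_iff:
  assumes W: "W \<in> carrier_mat n k"
  shows "gdet W = 0 \<longleftrightarrow> (\<exists>x\<in>carrier_mat k 1. x \<noteq> 0\<^sub>m k 1 \<and> W * x = 0\<^sub>m n 1)"
proof -
  note [simp] = carrier_matD[OF W]
  have "adj W * W * x = 0\<^sub>m k 1 \<longleftrightarrow> W * x = 0\<^sub>m n 1" if x: "x \<in> carrier_mat k 1" for x
  proof
    note [simp] = carrier_matD[OF x]
    assume *: "adj W * W * x = 0\<^sub>m k 1"
    have "adj (W * x) * (W * x) = adj x * (adj W * W * x)" by (simp add: adj_mult mat_assoc)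
    also have "\<dots> = 0\<^sub>m 1 1" unfolding * by simp
    finally have "(adj (W * x) * (W * x)) $$ (0,0) = 0" by (simp only:) simp
    hence "of_real (\<Sum>i<n. (cmod ((W * x) $$ (i,0)))\<^sup>2) = (of_real 0 :: complex)"
      using norm_col[of "W * x" n] by simp
    hence "(\<Sum>i<n. (cmod ((W * x) $$ (i,0)))\<^sup>2) = 0" by (simp only: of_real_eq_iff)
    hence "\<forall>i<n. (W * x) $$ (i,0) = 0" by (subst (asm) sum_nonneg_eq_0_iff) auto
    thus "W * x = 0\<^sub>m n 1" by (intro eq_matI) auto
  next
    note [simp] = carrier_matD[OF x]
    assume "W * x = 0\<^sub>m n 1"
    thus "adj W * W * x = 0\<^sub>m k 1" by (simp add: mat_assoc)
  qed
  moreover have "gdet W = 0 \<longleftrightarrow> det (adj W * W) = 0" by (simp add: det_gram)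
  ultimately show ?thesis using det_eq_0_iff_mat[of "adj W * W" k] by auto
qed

lemma gdet_pos:
  assumes "W \<in> carrier_mat n k" "L \<in> carrier_mat k n" "L * W = 1\<^sub>m k"
  shows "0 < gdet W"
proof -
  note [simp] = carrier_matD[OF assms(1)] carrier_matD[OF assms(2)]
  have "gdet W \<noteq> 0"
  proof
    assume "gdet W = 0"
    then obtain x where x: "x \<in> carrier_mat k 1" "x \<noteq> 0\<^sub>m k 1" "W * x = 0\<^sub>m n 1"
      using gdet_eq_0_iff[OF assms(1)] by blast
    have "x = L * W * x" unfolding assms(3) using x by simp
    also have "\<dots> = L * (W * x)" using x by (simp add: mat_assoc)
    also have "\<dots> = 0\<^sub>m k 1" unfolding x(3) using assms(2) by simp
    finally show False using x by simp
  qed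
  thus ?thesis using gdet_nonneg[of W] by simp
qed

lemma gdet_boundedI: "(\<And>W. W \<in> carrier_mat n k \<Longrightarrow> gdet (Z * W) \<le> c * gdet W) \<Longrightarrow> gdet_bounded n k c Z"
  by (auto simp: gdet_bounded_def)

lemma gdet_bounded_mult:
  assumes "gdet_bounded n k c Z" "gdet_bounded n k e Y" "Z \<in> carrier_mat n n" "Y \<in> carrier_mat n n" "0 \<le> c"
  shows "gdet_bounded n k (c * e) (Z * Y)"
proof (rule gdet_boundedI)
  fix W :: "complex mat" assume W: "W \<in> carrier_mat n k"
  have "gdet (Z * Y * W) = gdet (Z * (Y * W))" using assms(3,4) W by (simp add: mat_assoc)
  also have "\<dots> \<le> c * gdet (Y * W)" using assms(1,4) W by (auto simp: gdet_bounded_def)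
  also have "\<dots> \<le> c * (e * gdet W)" using assms(2,5) W by (intro mult_left_mono) (auto simp: gdet_bounded_def)
  finally show "gdet (Z * Y * W) \<le> c * e * gdet W" by simp
qed

text \<open>Lets a factor be exchanged for another one with the same Gram matrix, as
  \<open>log_majorization\<close> does to pass from Y to B.\<close>

lemma gdet_bounded_gram_cong:
  assumes "adj Z * Z = adj Y * Y" "Z \<in> carrier_mat n n" "Y \<in> carrier_mat n n"
  shows "gdet_bounded n k c Z \<longleftrightarrow> gdet_bounded n k c Y"
proof -
  have "gdet (Z * W) = gdet (Y * W)" if "W \<in> carrier_mat n k" for W
  proof -
    note [simp] = carrier_matD[OF that] carrier_matD[OF assms(2)] carrier_matD[OF assms(3)]
    have "adj (Z * W) * (Z * W) = adj W * (adj Z * Z * W)" by (simp add: adj_mult mat_assoc)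
    also have "\<dots> = adj (Y * W) * (Y * W)" unfolding assms(1) by (simp add: adj_mult mat_assoc)
    finally show ?thesis by (simp add: gdet_def)
  qed
  thus ?thesis by (auto simp: gdet_bounded_def)
qed

text \<open>For \<open>k <= n\<close>, \<open>U * first_cols n k\<close> consists of the first
  \<open>k\<close> columns of \<open>U\<close>; with sorted eigenvalues these are top
  eigenvectors.\<close>

definition first_cols :: "nat \<Rightarrow> nat \<Rightarrow> complex mat" where
  "first_cols n k = mat n k (\<lambda>(i,j). if i = j then 1 else 0)"

lemma first_cols_dim [simp]: "dim_row (first_cols n k) = n" "dim_col (first_cols n k) = k"
  by (simp_all add: first_cols_def)

lemma first_cols_carrier [simp]: "first_cols n k \<in> carrier_mat n k"
  by (simp add: first_cols_def)

lemma rdiag_first_cols: "k \<le> n \<Longrightarrow> rdiag n d * first_cols n k = first_cols n k * rdiag k d"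
  by (rule eq_matI) (auto simp: rdiag_mult_index[where m = k] mult_rdiag_index[where m = n] first_cols_def
      simp del: index_mult_mat(1))

lemma adj_first_cols_mult: 
  assumes "k \<le> n" shows "adj (first_cols n k) * first_cols n k = 1\<^sub>m k"
proof (rule eq_matI)
  fix i j assume "i < dim_row (1\<^sub>m k)" "j < dim_col (1\<^sub>m k)"
  hence ij: "i < k" "j < k" by auto
  have "(adj (first_cols n k) * first_cols n k) $$ (i,j) = (\<Sum>l<n. adj (first_cols n k) $$ (i,l) * first_cols n k $$ (l,j))"
    by (rule index_mult_sum[where n = k and l = k]) (use ij in auto)
  also have "\<dots> = (\<Sum>l<n. if l = i then (if i = j then 1 else 0) else 0)"
    using ij by (intro sum.cong) (auto simp: first_cols_def)
  finally show "(adj (first_cols n k) * first_cols n k) $$ (i,j) = 1\<^sub>m k $$ (i,j)" using ij assms by auto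
qed auto

lemma first_cols_conj: "k \<le> n \<Longrightarrow> adj (first_cols n k) * (rdiag n d * first_cols n k) = rdiag k d"
  by (simp add: rdiag_first_cols mat_assoc[symmetric] adj_first_cols_mult)

text \<open>The bound is attained on the top \<open>k\<close> eigenvectors, which gives one
  direction. Conversely, \<open>adj Z * Z\<close> compressed to the column space of \<open>W\<close>
  has eigenvalues below \<open>d\<close> by interlacing; a \<open>W\<close> with dependent columns
  makes both sides zero.\<close>

lemma gdet_bounded_spec:
  assumes Z: "Z \<in> carrier_mat n n" and U: "unitary n U" and eq: "adj Z * Z = spec_mat n U d"
    and d: "decr_below n d" "\<And>i. i < n \<Longrightarrow> 0 \<le> d i" and k: "k \<le> n"
  shows "gdet_bounded n k c Z \<longleftrightarrow> (\<Prod>i<k. d i) \<le> c"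
proof
  note [simp] = unitaryD[OF U] carrier_matD[OF Z]
  assume bound: "gdet_bounded n k c Z"
  define W where "W = U * first_cols n k"
  have [simp]: "W \<in> carrier_mat n k" "dim_row W = n" "dim_col W = k" by (simp_all add: W_def)
  have "adj W * W = 1\<^sub>m k" 
    unfolding W_def using k
    by (simp add: adj_mult mat_assoc cancel_mult[of "adj U" U n] adj_first_cols_mult)
  hence 1: "gdet W = 1" by (simp add: gdet_def)
  have "adj (Z * W) * (Z * W) = adj W * (adj Z * Z * W)" by (simp add: adj_mult mat_assoc)
  also have "\<dots> = adj (first_cols n k) * (adj U * (spec_mat n U d * U)) * first_cols n k"
    unfolding eq W_def by (simp add: adj_mult mat_assoc)
  also have "\<dots> = rdiag k d" unfolding spec_conj[OF U] using k by (simp add: mat_assoc first_cols_conj)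
  finally have "gdet (Z * W) = (\<Prod>i<k. d i)" by (rule gdet_eq_prod_rdiag)
  thus "(\<Prod>i<k. d i) \<le> c" using bound 1 by (auto simp: gdet_bounded_def dest: bspec[of _ _ W])
next
  note [simp] = unitaryD[OF U] carrier_matD[OF Z]
  assume c: "(\<Prod>i<k. d i) \<le> c"
  show "gdet_bounded n k c Z"
  proof (rule gdet_boundedI)
    fix W :: "complex mat" assume W: "W \<in> carrier_mat n k"
    note [simp] = carrier_matD[OF W]
    show "gdet (Z * W) \<le> c * gdet W"
    proof (cases "gdet W = 0")
      case True
      then obtain x where x: "x \<in> carrier_mat k 1" "x \<noteq> 0\<^sub>m k 1" "W * x = 0\<^sub>m n 1"
        using gdet_eq_0_iff[OF W] by blast
      have "Z * W * x = 0\<^sub>m n 1" using x Z by (simp add: mat_assoc)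
      hence "gdet (Z * W) = 0" using gdet_eq_0_iff[of "Z * W" n k] x by auto
      thus ?thesis using True by simp
    next
      case False
      obtain Q g where Q: "unitary k Q" and g: "\<forall>i<k. 0 \<le> g i" and WW: "adj W * W = spec_mat k Q g"
        using gram_spec[OF W] by blast
      note [simp] = unitaryD[OF Q]
      have "(\<Prod>i<k. g i) \<noteq> 0" using False gdet_eq_prod[OF Q WW] by simp
      hence gp: "0 < g i" if "i < k" for i using g that by (metis finite_lessThan less_eq_real_def lessThan_iff prod_zero_iff)
      \<comment> \<open>\<open>T\<close> turns the columns of \<open>W\<close> into orthonormal
        ones. Both sides of the claim scale by the same \<open>(cmod (det T))^2\<close>, so it
        suffices to treat \<open>V = W * T\<close>.\<close>
      define T where "T = Q * rdiag k (\<lambda>i. 1 / sqrt (g i))"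
      have T[simp]: "T \<in> carrier_mat k k" "dim_row T = k" "dim_col T = k" by (simp_all add: T_def)
      define V where "V = W * T"
      have [simp]: "V \<in> carrier_mat n k" "dim_row V = n" "dim_col V = k" by (simp_all add: V_def)
      have "adj V * V = rdiag k (\<lambda>i. 1 / sqrt (g i)) * (adj Q * (adj W * W * Q)) * rdiag k (\<lambda>i. 1 / sqrt (g i))"
        unfolding V_def T_def by (simp add: adj_mult mat_assoc)
      also have "\<dots> = rdiag k (\<lambda>_. 1)"
        unfolding WW spec_conj[OF Q] rdiag_mult
      proof (rule rdiag_cong)
        fix i assume "i < k"
        thus "1 / sqrt (g i) * g i * (1 / sqrt (g i)) = 1"
          using gp[of i] by (simp add: field_simps real_sqrt_mult[symmetric])
      qed
      finally have VV: "adj V * V = 1\<^sub>m k" by (simp add: rdiag_one)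
      hence V1: "gdet V = 1" by (simp add: gdet_def)
      obtain R m where R: "unitary k R" and m: "decr_below k m" "\<forall>i<k. 0 \<le> m i" and ZV: "adj (Z * V) * (Z * V) = spec_mat k R m"
        using gram_spec[of "Z * V" n k] by auto
      note [simp] = unitaryD[OF R]
      \<comment> \<open>In eigenvector coordinates of \<open>adj Z * Z\<close>, this isometry
        compresses \<open>rdiag n d\<close> to the diagonalised Gram matrix of
        \<open>Z * V\<close>.\<close>
      define B where "B = adj U * (V * R)"
      have B: "B \<in> carrier_mat n k" by (simp add: B_def)
      have "adj B * B = adj R * (adj V * V) * R"
        unfolding B_def by (simp add: adj_mult mat_assoc cancel_mult[of U "adj U" n])
      hence B1: "adj B * B = 1\<^sub>m k" unfolding VV by simp
      have "adj B * (rdiag n d * B) = adj R * (adj V * (spec_mat n U d * (V * R)))"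
        unfolding B_def spec_mat_def by (simp add: adj_mult mat_assoc)
      also have "\<dots> = adj R * (adj (Z * V) * (Z * V) * R)"
        unfolding eq[symmetric] by (simp add: adj_mult mat_assoc)
      also have "\<dots> = rdiag k m" unfolding ZV spec_conj[OF R] ..
      finally have "m i \<le> d i" if "i < k" for i
        using interlacing[OF B B1 _ d(1) m(1) that k] by simp
      hence "(\<Prod>i<k. m i) \<le> (\<Prod>i<k. d i)" using m by (intro prod_mono) auto
      hence "gdet (Z * V) \<le> (\<Prod>i<k. d i)" using gdet_eq_prod[OF R ZV] by simp
      also have "\<dots> \<le> c * gdet V" using c V1 by simp
      finally have "(cmod (det T))\<^sup>2 * gdet (Z * W) \<le> (cmod (det T))\<^sup>2 * (c * gdet W)"
        using gdet_mult_right[of "Z * W" n k T] gdet_mult_right[of W n k T] W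
        by (simp add: V_def mat_assoc mult_ac)
      moreover have "det T \<noteq> 0" using V1 gdet_mult_right[of W n k T] W by (auto simp: V_def)
      ultimately show ?thesis by simp
    qed
  qed
qed

text \<open>Tested on the span of the top eigenvectors of \<^term>\<open>Z * adj Z\<close>, pulled back by \<^term>\<open>adj Z\<close>.\<close>

lemma gdet_bounded_adj:
  assumes Z: "Z \<in> carrier_mat n n" and c: "0 \<le> c" and k: "k \<le> n" and bound: "gdet_bounded n k c Z"
  shows "gdet_bounded n k c (adj Z)"
proof -
  note [simp] = carrier_matD[OF Z]
  obtain V e where V: "unitary n V" and e: "decr_below n e" "\<forall>i<n. 0 \<le> e i" and eq: "adj (adj Z) * adj Z = spec_mat n V e"
    using gram_spec[of "adj Z" n n] Z by auto
  note [simp] = unitaryD[OF V]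
  have eq': "Z * adj Z = V * rdiag n e * adj V" using eq by (simp add: spec_mat_def)
  define W where "W = adj Z * (V * first_cols n k)"
  have W: "W \<in> carrier_mat n k" by (simp add: W_def)
  have ep: "0 \<le> (\<Prod>i<k. e i)" using e k by (intro prod_nonneg) auto
  have "adj W * W = adj (first_cols n k) * (adj V * (Z * adj Z) * V) * first_cols n k"
    unfolding W_def by (simp add: adj_mult mat_assoc)
  also have "\<dots> = adj (first_cols n k) * (rdiag n e * first_cols n k)"
    unfolding eq' by (simp add: mat_assoc cancel_mult[of "adj V" V n])
  finally have 1: "gdet W = (\<Prod>i<k. e i)" using k by (simp add: first_cols_conj gdet_eq_prod_rdiag)
  have ZW: "Z * W = V * rdiag n e * first_cols n k"
  proof -
    have "Z * W = Z * adj Z * V * first_cols n k" unfolding W_def by (simp add: mat_assoc)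
    thus ?thesis unfolding eq' by (simp add: mat_assoc cancel_mult[of "adj V" V n])
  qed
  have "adj (Z * W) * (Z * W) = adj (first_cols n k) * (rdiag n e * rdiag n e * first_cols n k)"
    unfolding ZW by (simp add: adj_mult mat_assoc cancel_mult[of "adj V" V n])
  hence "gdet (Z * W) = (\<Prod>i<k. e i * e i)"
    using k by (simp add: rdiag_mult first_cols_conj gdet_eq_prod_rdiag)
  hence "(\<Prod>i<k. e i) * (\<Prod>i<k. e i) \<le> c * (\<Prod>i<k. e i)"
    using bound W 1 by (auto simp: gdet_bounded_def prod.distrib)
  \<comment> \<open>Cancels one factor of the squared product; if the product is zero, the claim is
    \<open>0 <= c\<close>.\<close>
  moreover have "p \<le> c" if "p * p \<le> c * p" "0 \<le> p" for p
    using that c by (cases "p = 0") (auto simp: mult_le_cancel_right)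
  ultimately have "(\<Prod>i<k. e i) \<le> c" using ep by blast
  thus ?thesis using gdet_bounded_spec[OF _ V eq e(1) _ k, of c] Z e(2) by simp
qed

text \<open>The hypothesis on \<^term>\<open>T\<close> makes \<^term>\<open>Z\<close> similar to a Hermitian matrix: products of eigenvalues
  are dominated by those of singular values. Since \<^const>\<open>gdet_bounded\<close> refers to
  squared singular values, the left-hand side is squared.\<close>

lemma weyl_top_eigenvalues:
  assumes Z: "Z \<in> carrier_mat n n" and T: "T \<in> carrier_mat n n" "T' \<in> carrier_mat n n" "T' * T = 1\<^sub>m n"
    and V: "unitary n V" and ZT: "Z * T = T * spec_mat n V m" and k: "k \<le> n" and bound: "gdet_bounded n k c Z"
  shows "(\<Prod>i<k. m i)\<^sup>2 \<le> c"
proof -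
  note [simp] = carrier_matD[OF Z] carrier_matD[OF T(1)] carrier_matD[OF T(2)] unitaryD[OF V]
  \<comment> \<open>The columns are eigenvectors of \<open>Z\<close>, so \<open>Z\<close> acts on
    \<open>W\<close> as right multiplication by a diagonal matrix and scales its Gram determinant by
    the squared product of the eigenvalues.\<close>
  define W where "W = T * (V * first_cols n k)"
  have W: "W \<in> carrier_mat n k" by (simp add: W_def)
  have "Z * W = Z * T * V * first_cols n k" unfolding W_def by (simp add: mat_assoc)
  also have "\<dots> = W * rdiag k m"
    unfolding ZT W_def spec_mat_def using k
    by (simp add: mat_assoc cancel_mult[of "adj V" V n] rdiag_first_cols)
  finally have "gdet (Z * W) = (\<Prod>i<k. m i)\<^sup>2 * gdet W"
    using gdet_mult_right[OF W, of "rdiag k m"] by (simp add: det_rdiag del: of_real_prod)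
  moreover have "gdet (Z * W) \<le> c * gdet W" using bound W by (auto simp: gdet_bounded_def)
  moreover have "0 < gdet W"
  proof (rule gdet_pos[OF W])
    show "adj (first_cols n k) * (adj V * T') * W = 1\<^sub>m k"
      unfolding W_def using k T(3)
      by (simp add: mat_assoc cancel_mult[of T' T n] cancel_mult[of "adj V" V n] adj_first_cols_mult)
  qed simp
  ultimately show ?thesis by simp
qed

section \<open>Araki's inequality\<close>

text \<open>The one-parameter group with generator \<open>spec_mat n U h\<close>; real powers of positive definite matrices
  are written in this form.\<close>

definition exp_mat :: "nat \<Rightarrow> complex mat \<Rightarrow> (nat \<Rightarrow> real) \<Rightarrow> real \<Rightarrow> complex mat" where
  "exp_mat n U h x = spec_mat n U (\<lambda>i. exp (x * h i))"

lemma exp_mat_carrier [simp]: "U \<in> carrier_mat n n \<Longrightarrow> exp_mat n U h x \<in> carrier_mat n n"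
  by (simp add: exp_mat_def)

lemma exp_mat_dim [simp]: "dim_row (exp_mat n U h x) = dim_row U" "dim_col (exp_mat n U h x) = dim_row U"
  by (simp_all add: exp_mat_def)

lemma adj_exp_mat [simp]: "U \<in> carrier_mat n n \<Longrightarrow> adj (exp_mat n U h x) = exp_mat n U h x"
  by (simp add: exp_mat_def)

lemma exp_mat_mult: "unitary n U \<Longrightarrow> exp_mat n U h x * exp_mat n U h y = exp_mat n U h (x + y)"
  by (simp add: exp_mat_def spec_mult distrib_right exp_add)

lemma exp_mat_mult_left:
  assumes "unitary n U" "dim_row C = n"
  shows "exp_mat n U h x * (exp_mat n U h y * C) = exp_mat n U h (x + y) * C"
  using assms unitaryD[OF assms(1)] by (simp add: exp_mat_mult[symmetric] mat_assoc)

lemma exp_mat_0: "unitary n U \<Longrightarrow> exp_mat n U h 0 = 1\<^sub>m n"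
  by (simp add: exp_mat_def spec_one)

lemma exp_mat_scale: "exp_mat n U (\<lambda>i. c * h i) x = exp_mat n U h (x * c)"
  by (simp add: exp_mat_def mult_ac)

text \<open>By compactness a missing point \<open>s\<close> would have nearest neighbours
  \<open>a < s < b\<close> in \<open>S\<close>; their midpoint lies in \<open>S\<close> and strictly
  inside that gap.\<close>

lemma closed_midpoint_interval:
  fixes S :: "real set"
  assumes "closed S" "S \<subseteq> {0..1}" "0 \<in> S" "1 \<in> S" and mid: "\<And>s u. s \<in> S \<Longrightarrow> u \<in> S \<Longrightarrow> (s + u) / 2 \<in> S"
  shows "S = {0..1}"
proof (rule ccontr)
  assume "S \<noteq> {0..1}"
  then obtain s where s: "s \<in> {0..1}" "s \<notin> S" using assms(2) by blast
  have "compact (S \<inter> {0..s})" "S \<inter> {0..s} \<noteq> {}"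
    using compact_Int_closed[of "{0..s}" S] assms s by (auto simp: Int_commute)
  then obtain a where "a \<in> S \<inter> {0..s}" "\<forall>t\<in>S \<inter> {0..s}. t \<le> a"
    using compact_attains_sup[of "S \<inter> {0..s}"] by blast
  hence a: "a \<in> S" "a \<le> s" "\<And>x. x \<in> S \<Longrightarrow> 0 \<le> x \<Longrightarrow> x \<le> s \<Longrightarrow> x \<le> a"
    by simp_all
  have "compact (S \<inter> {s..1})" "S \<inter> {s..1} \<noteq> {}"
    using compact_Int_closed[of "{s..1}" S] assms s by (auto simp: Int_commute)
  then obtain b where "b \<in> S \<inter> {s..1}" "\<forall>t\<in>S \<inter> {s..1}. b \<le> t"
    using compact_attains_inf[of "S \<inter> {s..1}"] by blast
  hence b: "b \<in> S" "s \<le> b" "\<And>x. x \<in> S \<Longrightarrow> s \<le> x \<Longrightarrow> x \<le> 1 \<Longrightarrow> b \<le> x"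
    by simp_all
  have ab: "a < s" "s < b" using a b s by (metis less_eq_real_def)+
  have m: "(a + b) / 2 \<in> S" using mid a b by blast
  hence "0 \<le> (a + b) / 2" "(a + b) / 2 \<le> 1" using assms(2) by (auto dest!: subsetD)
  thus False using a(3)[OF m] b(3)[OF m] ab by (cases "(a + b) / 2 \<le> s") auto
qed

text \<open>By the Leibniz formula the Gram determinant is polynomial in the entries and their
  conjugates. Serves the closedness of the exponent set in \<open>araki\<close>.\<close>

lemma continuous_gdet:
  fixes A :: "real \<Rightarrow> complex mat"
  assumes A: "\<And>x. A x \<in> carrier_mat n k"
    and c: "\<And>i j. i < n \<Longrightarrow> j < k \<Longrightarrow> continuous_on UNIV (\<lambda>x. A x $$ (i,j))"
  shows "continuous_on UNIV (\<lambda>x. gdet (A x))"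
proof -
  have d: "dim_row (A x) = n" "dim_col (A x) = k" for x using A[of x] by auto
  have 1: "adj (A x) * A x \<in> carrier_mat k k" for x using d by simp
  have "gdet (A x) = Re (\<Sum>p | p permutes {0..<k}. signof p *
      (\<Prod>i = 0..<k. \<Sum>l<n. cnj (A x $$ (l,i)) * A x $$ (l, p i)))" for x
    unfolding gdet_def det_def'[OF 1]
  proof (intro arg_cong[of _ _ Re] sum.cong refl arg_cong2[of _ _ _ _ "(*)"] prod.cong)
    fix p i assume p: "p \<in> {p. p permutes {0..<k}}" and i: "i \<in> {0..<k}"
    hence "p i < k" using permutes_in_image[of p "{0..<k}" i] by auto
    thus "(adj (A x) * A x) $$ (i, p i) = (\<Sum>l<n. cnj (A x $$ (l,i)) * A x $$ (l, p i))"
      using i d by (subst index_mult_sum[where n = k and m = n and l = k]) auto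
  qed
  moreover have "continuous_on UNIV (\<lambda>x. Re (\<Sum>p | p permutes {0..<k}. signof p *
      (\<Prod>i = 0..<k. \<Sum>l<n. cnj (A x $$ (l,i)) * A x $$ (l, p i))))"
  proof (intro continuous_intros)
    fix p i l assume p: "p \<in> {p. p permutes {0..<k}}" and i: "i \<in> {0..<k}" and l: "l \<in> {..<n}"
    hence "p i < k" using permutes_in_image[of p "{0..<k}" i] by auto
    thus "continuous_on UNIV (\<lambda>x. A x $$ (l, i))" "continuous_on UNIV (\<lambda>x. A x $$ (l, p i))"
      using c i l by auto
  qed
  ultimately show ?thesis by presburger
qed

lemma continuous_index_mult:
  fixes A B :: "real \<Rightarrow> complex mat"
  assumes "\<And>x. A x \<in> carrier_mat n m" "\<And>x. B x \<in> carrier_mat m l"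
    and "\<And>i j. i < n \<Longrightarrow> j < m \<Longrightarrow> continuous_on UNIV (\<lambda>x. A x $$ (i,j))"
    and "\<And>i j. i < m \<Longrightarrow> j < l \<Longrightarrow> continuous_on UNIV (\<lambda>x. B x $$ (i,j))"
    and ij: "i < n" "j < l"
  shows "continuous_on UNIV (\<lambda>x. (A x * B x) $$ (i,j))"
proof -
  have "(A x * B x) $$ (i,j) = (\<Sum>k<m. A x $$ (i,k) * B x $$ (k,j))" for x
    by (rule index_mult_sum[OF assms(1,2) ij])
  moreover have "continuous_on UNIV (\<lambda>x. \<Sum>k<m. A x $$ (i,k) * B x $$ (k,j))"
    by (intro continuous_intros assms ij) auto
  ultimately show ?thesis by presburger
qed

lemma continuous_exp_mat:
  assumes "U \<in> carrier_mat n n" "i < n" "j < n"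
  shows "continuous_on UNIV (\<lambda>x. exp_mat n U h x $$ (i,j))"
  unfolding exp_mat_def spec_index[OF assms] by (intro continuous_intros)

text \<open>The exponents for which the bound holds are closed under midpoints: with \<open>m = (a + b) / 2\<close>,
  \<open>P\<^sup>m Q\<^bsup>2m\<^esup> P\<^sup>m\<close> is similar to \<open>(P\<^sup>b Q\<^sup>b) (Q\<^sup>a P\<^sup>a)\<close>.\<close>

theorem araki:
  assumes U: "unitary n U" and V: "unitary n V" and k: "k \<le> n" and c: "0 < c"
    and bound: "gdet_bounded n k c (exp_mat n V q 1 * exp_mat n U p 1)" and s: "0 \<le> s" "s \<le> 1"
  shows "gdet_bounded n k (c powr s) (exp_mat n V q s * exp_mat n U p s)"
proof -
  note [simp] = unitaryD[OF U] unitaryD[OF V]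
  let ?P = "exp_mat n U p" and ?Q = "exp_mat n V q"
  define F where "F = (\<lambda>x. ?Q x * ?P x)"
  have F[simp]: "F x \<in> carrier_mat n n" "dim_row (F x) = n" "dim_col (F x) = n" for x
    by (simp_all add: F_def)
  have adjF: "adj (F x) = ?P x * ?Q x" for x by (simp add: F_def adj_mult)
  define S where "S = {x \<in> {0..1}. gdet_bounded n k (c powr x) (F x)}"
  have "S = {0..1}"
  proof (rule closed_midpoint_interval)
    \<comment> \<open>Writing the set as an intersection over test matrices reduces closedness to
      one scalar inequality for each fixed \<open>W\<close>.\<close>
    have "S = {0..1} \<inter> (\<Inter>W\<in>carrier_mat n k. {x. gdet (F x * W) \<le> c powr x * gdet W})"
      by (auto simp: S_def gdet_bounded_def)
    moreover have "closed {x. gdet (F x * W) \<le> c powr x * gdet W}" if W: "W \<in> carrier_mat n k" for W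
    proof (rule closed_Collect_le)
      note [simp] = carrier_matD[OF W]
      have "continuous_on UNIV (\<lambda>x. F x $$ (i,j))" if "i < n" "j < n" for i j
        unfolding F_def by (rule continuous_index_mult[where m = n]) (use that in \<open>auto intro: continuous_exp_mat\<close>)
      hence "continuous_on UNIV (\<lambda>x. (F x * W) $$ (i,j))" if "i < n" "j < k" for i j
        by (intro continuous_index_mult[where m = n]) (use that W in auto)
      thus "continuous_on UNIV (\<lambda>x. gdet (F x * W))"
        by (intro continuous_gdet[where n = n and k = k]) auto
      show "continuous_on UNIV (\<lambda>x. c powr x * gdet W)"
        using c by (auto intro!: continuous_intros)
    qed
    ultimately show "closed S" by (auto intro!: closed_Int closed_INT)
    show "S \<subseteq> {0..1}" by (auto simp: S_def)
    show "1 \<in> S" using bound c by (simp add: S_def F_def)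
    have "F 0 = 1\<^sub>m n" using U V by (simp add: F_def exp_mat_0)
    thus "0 \<in> S" using c by (auto simp: S_def gdet_bounded_def)
  next
    fix a b assume ab: "a \<in> S" "b \<in> S"
    define m where "m = (a + b) / 2"
    have ms: "a + (b - m) = m" "b - m + m = b" "m + m = b + a" by (simp_all add: m_def field_simps)
    have m01: "0 \<le> m" "m \<le> 1" using ab by (auto simp: S_def m_def)
    define Z where "Z = adj (F b) * F a"
    have Z: "Z \<in> carrier_mat n n" by (simp add: Z_def)
    have domZ: "gdet_bounded n k (c powr b * c powr a) Z"
      unfolding Z_def using ab k by (intro gdet_bounded_mult gdet_bounded_adj) (auto simp: S_def)
    obtain X g where X: "unitary n X" and g: "decr_below n g" "\<forall>i<n. 0 \<le> g i" and Fm: "adj (F m) * F m = spec_mat n X g"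
      using gram_spec[OF F(1)] by blast
    \<comment> \<open>As \<open>a + (b - m) = m\<close>, the product ends in \<open>?P m\<close>;
      splitting \<open>?P b\<close> into \<open>?P (b - m) * ?P m\<close> then exposes the Gram
      matrix of \<open>F m\<close>.\<close>
    have "Z * ?P (b - m) = ?P b * (?Q (b + a) * ?P m)"
      unfolding Z_def adjF unfolding F_def using U V by (simp add: mat_assoc exp_mat_mult exp_mat_mult_left ms)
    also have "\<dots> = ?P (b - m) * (adj (F m) * F m)"
      unfolding adjF unfolding F_def using U V by (simp add: mat_assoc exp_mat_mult exp_mat_mult_left ms)
    finally have "Z * ?P (b - m) = ?P (b - m) * spec_mat n X g" unfolding Fm .
    hence "(\<Prod>i<k. g i)\<^sup>2 \<le> c powr b * c powr a"
      using U by (intro weyl_top_eigenvalues[OF Z _ _ _ X _ k domZ, where T = "?P (b - m)" and T' = "?P (m - b)"])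
        (auto simp: exp_mat_mult exp_mat_0)
    also have "\<dots> = (c powr m)\<^sup>2" by (simp add: power2_eq_square powr_add[symmetric] ms)
    finally have "(\<Prod>i<k. g i) \<le> c powr m" by (rule power2_le_imp_le) simp
    hence "gdet_bounded n k (c powr m) (F m)" using gdet_bounded_spec[OF F(1) X Fm g(1) _ k] g by simp
    thus "(a + b) / 2 \<in> S" using m01 by (simp add: S_def m_def)
  qed
  hence "s \<in> S" using s by simp
  thus ?thesis unfolding S_def F_def by simp
qed

section \<open>First-order expansion at 0\<close>

definition mat_deriv :: "nat \<Rightarrow> nat \<Rightarrow> (real \<Rightarrow> complex mat) \<Rightarrow> complex mat \<Rightarrow> bool" where
  "mat_deriv n m A A' \<longleftrightarrow> (\<forall>x. A x \<in> carrier_mat n m) \<and> A' \<in> carrier_mat n m \<and>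
     (\<forall>i<n. \<forall>j<m. ((\<lambda>x. A x $$ (i,j)) has_vector_derivative A' $$ (i,j)) (at 0))"

lemma mat_deriv_const: "C \<in> carrier_mat n m \<Longrightarrow> mat_deriv n m (\<lambda>_. C) (0\<^sub>m n m)"
  by (auto simp: mat_deriv_def)

lemma mat_deriv_mult:
  assumes A: "mat_deriv n m A A'" and B: "mat_deriv m l B B'"
  shows "mat_deriv n l (\<lambda>x. A x * B x) (A' * B 0 + A 0 * B')"
proof -
  have c: "A x \<in> carrier_mat n m" "B x \<in> carrier_mat m l" "A' \<in> carrier_mat n m" "B' \<in> carrier_mat m l" for x
    using A B by (auto simp: mat_deriv_def)
  note [simp] = c(1)[THEN carrier_matD(1)] c(1)[THEN carrier_matD(2)] c(2)[THEN carrier_matD(1)] c(2)[THEN carrier_matD(2)]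
    carrier_matD[OF c(3)] carrier_matD[OF c(4)]
  have "((\<lambda>x. (A x * B x) $$ (i,j)) has_vector_derivative (A' * B 0 + A 0 * B') $$ (i,j)) (at 0)"
    if ij: "i < n" "j < l" for i j
  proof -
    have "(A x * B x) $$ (i,j) = (\<Sum>k<m. A x $$ (i,k) * B x $$ (k,j))" for x
      by (rule index_mult_sum[OF c(1,2) ij])
    moreover have "((\<lambda>x. \<Sum>k<m. A x $$ (i,k) * B x $$ (k,j)) has_vector_derivative
        (\<Sum>k<m. A 0 $$ (i,k) * B' $$ (k,j) + A' $$ (i,k) * B 0 $$ (k,j))) (at 0)"
      using A B ij by (intro has_vector_derivative_sum has_vector_derivative_mult) (auto simp: mat_deriv_def)
    moreover have "(\<Sum>k<m. A 0 $$ (i,k) * B' $$ (k,j) + A' $$ (i,k) * B 0 $$ (k,j)) = (A' * B 0 + A 0 * B') $$ (i,j)"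
    proof -
      have "(A' * B 0 + A 0 * B') $$ (i,j) = (A' * B 0) $$ (i,j) + (A 0 * B') $$ (i,j)" using ij by simp
      thus ?thesis using index_mult_sum[OF c(3,2) ij] index_mult_sum[OF c(1,4) ij]
        by (simp add: sum.distrib)
    qed
    ultimately show ?thesis by (simp only:)
  qed
  thus ?thesis unfolding mat_deriv_def by simp
qed

lemma mat_deriv_exp_mat:
  assumes U: "unitary n U"
  shows "mat_deriv n n (exp_mat n U h) (spec_mat n U h)"
proof -
  note [simp] = unitaryD[OF U]
  have "((\<lambda>x. exp_mat n U h x $$ (i,j)) has_vector_derivative spec_mat n U h $$ (i,j)) (at 0)" if "i < n" "j < n" for i j
  proof -
    have "((\<lambda>x. exp (x * h k)) has_vector_derivative h k) (at 0)" for k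
      unfolding has_real_derivative_iff_has_vector_derivative[symmetric]
      by (auto intro!: derivative_eq_intros)
    hence "((\<lambda>x. of_real (exp (x * h k)) :: complex) has_vector_derivative of_real (h k)) (at 0)" for k
      by (intro bounded_linear.has_vector_derivative[OF bounded_linear_of_real])
    thus ?thesis unfolding exp_mat_def spec_index[OF unitaryD(1)[OF U] that]
      by (intro has_vector_derivative_sum has_vector_derivative_mult_left has_vector_derivative_mult_right)
  qed
  thus ?thesis by (simp add: mat_deriv_def)
qed

text \<open>Jacobi's formula at the identity. In the Leibniz sum a permutation other than
  \<open>id\<close> contributes at least two off-diagonal factors, both zero at 0, so its term has
  derivative 0.\<close>

lemma mat_deriv_det:
  assumes M: "mat_deriv k k M M'" and M0: "M 0 = 1\<^sub>m k"
  shows "((\<lambda>x. det (M x)) has_vector_derivative (\<Sum>i<k. M' $$ (i,i))) (at 0)"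
proof -
  have c: "M x \<in> carrier_mat k k" for x using M by (simp add: mat_deriv_def)
  have "((\<lambda>x. signof p * (\<Prod>i = 0..<k. M x $$ (i, p i))) has_vector_derivative
      (if p = id then (\<Sum>i<k. M' $$ (i,i)) else 0)) (at 0)" if p: "p permutes {0..<k}" for p
  proof -
    have pk: "p i < k" if "i < k" for i using permutes_in_image[OF p, of i] that by auto
    have D: "((\<lambda>x. \<Prod>i = 0..<k. M x $$ (i, p i)) has_vector_derivative
       (\<Sum>i = 0..<k. M' $$ (i, p i) * (\<Prod>j\<in>{0..<k} - {i}. M 0 $$ (j, p j)))) (at 0)"
    proof -
      have "((\<lambda>x. M x $$ (i, p i)) has_derivative (\<lambda>y. y *\<^sub>R M' $$ (i, p i))) (at 0)" if "i \<in> {0..<k}" for i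
        using M pk that by (auto simp: mat_deriv_def has_vector_derivative_def)
      from has_derivative_prod[where I = "{0..<k}" and f = "\<lambda>i x. M x $$ (i, p i)", OF this] show ?thesis
        unfolding has_vector_derivative_def by (simp add: scaleR_sum_right)
    qed
    show ?thesis
    proof (cases "p = id")
      case True
      have "(\<Sum>i = 0..<k. M' $$ (i, p i) * (\<Prod>j\<in>{0..<k} - {i}. M 0 $$ (j, p j))) = (\<Sum>i<k. M' $$ (i,i))"
        unfolding atLeast0LessThan by (intro sum.cong) (auto simp: True M0)
      thus ?thesis using D True by (simp add: sign_id)
    next
      case False
      then obtain a where a: "p a \<noteq> a" by (auto simp: fun_eq_iff)
      hence ak: "a < k" using p by (auto simp: permutes_def)
      \<comment> \<open>A second moved index: after differentiating one factor, the one at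
        \<open>a\<close> or the one at \<open>p a\<close> remains and vanishes at 0.\<close>
      have b: "p (p a) \<noteq> p a" using a permutes_inj[OF p] by (auto dest: injD)
      have "(\<Prod>j\<in>{0..<k} - {i}. M 0 $$ (j, p j)) = 0" if "i < k" for i
      proof (cases "i = a")
        case True
        thus ?thesis using a b ak pk by (intro prod_zero bexI[of _ "p a"]) (auto simp: M0)
      next
        case False
        thus ?thesis using a b ak pk by (intro prod_zero bexI[of _ a]) (auto simp: M0)
      qed
      hence "(\<Sum>i = 0..<k. M' $$ (i, p i) * (\<Prod>j\<in>{0..<k} - {i}. M 0 $$ (j, p j))) = 0"
        by (intro sum.neutral ballI) (simp only: atLeastLessThan_iff mult_zero_right)
      hence "((\<lambda>x. \<Prod>i = 0..<k. M x $$ (i, p i)) has_vector_derivative 0) (at 0)" using D by simp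
      from has_vector_derivative_mult_right[OF this, of "signof p"] show ?thesis using False by simp
    qed
  qed
  hence "((\<lambda>x. \<Sum>p | p permutes {0..<k}. signof p * (\<Prod>i = 0..<k. M x $$ (i, p i))) has_vector_derivative
      (\<Sum>p | p permutes {0..<k}. if p = id then (\<Sum>i<k. M' $$ (i,i)) else 0)) (at 0)"
    by (intro has_vector_derivative_sum) auto
  moreover have "(\<Sum>p | p permutes {0..<k}. if p = id then (\<Sum>i<k. M' $$ (i,i)) else 0) = (\<Sum>i<k. M' $$ (i,i))"
    using permutes_id[of "{0..<k}"] by (simp add: finite_permutations)
  ultimately show ?thesis by (simp add: det_def'[OF c])
qed

text \<open>Both sides of the inequality are 1 at \<open>x = 0\<close>, so a larger derivative on
  the left would break it just to the right of 0.\<close>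

lemma det_deriv_le:
  assumes M: "mat_deriv k k M M'" "M 0 = 1\<^sub>m k" and c: "0 < c"
    and le: "\<And>x. 0 \<le> x \<Longrightarrow> x \<le> 1 \<Longrightarrow> Re (det (M x)) \<le> c powr x"
  shows "Re (\<Sum>i<k. M' $$ (i,i)) \<le> ln c"
proof (rule ccontr)
  assume "\<not> ?thesis"
  hence neg: "ln c - Re (\<Sum>i<k. M' $$ (i,i)) < 0" by simp
  define g where "g = (\<lambda>x. c powr x - Re (det (M x)))"
  have "((\<lambda>x. Re (det (M x))) has_real_derivative Re (\<Sum>i<k. M' $$ (i,i))) (at 0)"
    unfolding has_real_derivative_iff_has_vector_derivative
    by (intro bounded_linear.has_vector_derivative[OF bounded_linear_Re] mat_deriv_det M)
  hence "(g has_real_derivative (ln c - Re (\<Sum>i<k. M' $$ (i,i)))) (at 0)"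
    unfolding g_def
  proof (rule DERIV_diff[rotated])
    show "((\<lambda>x. c powr x) has_real_derivative ln c) (at 0)"
      using c by (auto intro!: derivative_eq_intros)
  qed
  from DERIV_neg_dec_right[OF this neg] obtain d where d: "0 < d" "\<And>h. 0 < h \<Longrightarrow> h < d \<Longrightarrow> g h < g 0"
    by auto
  have "g 0 = 0" using M c by (simp add: g_def)
  \<comment> \<open>The minimum with 1 keeps the point in the range of \<open>le\<close>; the half
    keeps it below \<open>d\<close>.\<close>
  moreover have "0 \<le> g (min 1 (d / 2))" using le[of "min 1 (d / 2)"] d by (simp add: g_def)
  moreover have "0 < min 1 (d / 2)" "min 1 (d / 2) < d" using d(1) by (auto simp: min_def)
  ultimately show False using d(2)[of "min 1 (d / 2)"] by linarith
qed

section \<open>Log-majorization for the weighted geometric mean\<close>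

lemma gram_spec_pos:
  assumes Z: "Z \<in> carrier_mat n n" and L: "L \<in> carrier_mat n n" "L * Z = 1\<^sub>m n"
  shows "\<exists>U d. unitary n U \<and> decr_below n d \<and> (\<forall>i<n. 0 < d i) \<and> adj Z * Z = spec_mat n U d"
proof -
  obtain U d where *: "unitary n U" "decr_below n d" "\<forall>i<n. 0 \<le> d i" "adj Z * Z = spec_mat n U d"
    using gram_spec[OF Z] by blast
  have "(\<Prod>i<n. d i) \<noteq> 0" using gdet_pos[OF Z L] gdet_eq_prod[OF *(1,4)] by linarith
  hence "\<forall>i<n. d i \<noteq> 0" by simp
  hence "\<forall>i<n. 0 < d i" using *(3) by (metis less_eq_real_def)
  thus ?thesis using * by blast
qed

lemma spec_powr_eq_exp_mat:
  "(\<And>i. i < n \<Longrightarrow> 0 < y i) \<Longrightarrow> spec_mat n W (\<lambda>i. y i powr t) = exp_mat n W (\<lambda>i. ln (y i)) t"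
  unfolding exp_mat_def by (rule spec_cong) (metis powr_def less_irrefl)

text \<open>Dictionary: A is \<open>exp_mat n U a 1\<close> and B is \<open>exp_mat n V b 1\<close>.
  Then \<open>Y\<close> diagonalises A^{-1/2} B A^{-1/2}, \<open>G\<close> diagonalises the mean of
  A and B with weight \<open>t\<close>, and \<open>L\<close> diagonalises (1-t) log A + t log
  B.\<close>

lemma log_majorization:
  assumes U: "unitary n U" and V: "unitary n V" and W: "unitary n W" and C: "unitary n C" and X: "unitary n X"
    and t: "1 \<le> t" and k: "k \<le> n"
    and y: "\<And>i. i < n \<Longrightarrow> 0 < y i"
    and Y: "exp_mat n U a (-1/2) * (exp_mat n V b 1 * exp_mat n U a (-1/2)) = spec_mat n W y"
    and G: "exp_mat n U a (1/2) * (spec_mat n W (\<lambda>i. y i powr t) * exp_mat n U a (1/2)) = spec_mat n C g"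
    and g: "decr_below n g" "\<And>i. i < n \<Longrightarrow> 0 < g i"
    and L: "complex_of_real (1 - t) \<cdot>\<^sub>m spec_mat n U a + complex_of_real t \<cdot>\<^sub>m spec_mat n V b = spec_mat n X l"
  shows "(\<Sum>i<k. l i) \<le> (\<Sum>i<k. ln (g i))"
proof -
  note [simp] = unitaryD[OF U] unitaryD[OF V] unitaryD[OF W] unitaryD[OF C] unitaryD[OF X]
  define s where "s = 1 / t"
  have s: "0 \<le> s" "s \<le> 1" "t * s = 1" using t by (simp_all add: s_def)
  define w where "w = (\<lambda>i. ln (y i))"
  have Yw: "spec_mat n W y = exp_mat n W w 1"
    unfolding exp_mat_def w_def by (rule spec_cong) (simp add: y exp_ln)
  have Ytw: "spec_mat n W (\<lambda>i. y i powr t) = exp_mat n W w t"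
    unfolding w_def using y by (rule spec_powr_eq_exp_mat)
  define c where "c = (\<Prod>i<k. g i)"
  have c: "0 < c" unfolding c_def using g k by (intro prod_pos) auto
  \<comment> \<open>The Gram matrix of Y^{t/2} A^{1/2} is the geometric mean.\<close>
  have "gdet_bounded n k c (exp_mat n W w (t/2) * exp_mat n U a (1/2))"
  proof (subst gdet_bounded_spec[OF _ C _ g(1) _ k])
    show "adj (exp_mat n W w (t/2) * exp_mat n U a (1/2)) * (exp_mat n W w (t/2) * exp_mat n U a (1/2)) = spec_mat n C g"
      using W G by (simp add: adj_mult mat_assoc exp_mat_mult_left Ytw)
  qed (use g in \<open>auto simp: c_def less_imp_le\<close>)
  \<comment> \<open>\<open>araki\<close> starts from exponent 1, so the half powers are moved into
    the generators.\<close>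
  hence "gdet_bounded n k c (exp_mat n W (\<lambda>i. t/2 * w i) 1 * exp_mat n U (\<lambda>i. 1/2 * a i) 1)"
    by (simp only: exp_mat_scale mult_1)
  from araki[OF U W k c this s(1,2)]
  have dW: "gdet_bounded n k (c powr s) (exp_mat n W w (1/2) * exp_mat n U a (s/2))"
    unfolding exp_mat_scale using s(3) by (simp add: mult.commute)
  \<comment> \<open>Because \<open>t * s = 1\<close>, the power \<open>s\<close> has turned Y^t into
    Y. Expanding Y, its outer factors A^{-1/2} merge with A^{s/2}.\<close>
  have "adj (exp_mat n W w (1/2) * exp_mat n U a (s/2)) * (exp_mat n W w (1/2) * exp_mat n U a (s/2))
      = adj (exp_mat n V b (1/2) * exp_mat n U a ((s-1)/2)) * (exp_mat n V b (1/2) * exp_mat n U a ((s-1)/2))"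
  proof -
    have "adj (exp_mat n W w (1/2) * exp_mat n U a (s/2)) * (exp_mat n W w (1/2) * exp_mat n U a (s/2))
       = exp_mat n U a (s/2) * (spec_mat n W y * exp_mat n U a (s/2))"
      using W by (simp add: adj_mult mat_assoc exp_mat_mult_left Yw)
    also have "\<dots> = exp_mat n U a ((s-1)/2) * (exp_mat n V b 1 * exp_mat n U a ((s-1)/2))"
      unfolding Y[symmetric] using U by (simp add: mat_assoc exp_mat_mult exp_mat_mult_left diff_divide_distrib)
    finally show ?thesis using V by (simp add: adj_mult mat_assoc exp_mat_mult_left)
  qed
  from gdet_bounded_gram_cong[OF this, of n k "c powr s"] dW
  have "gdet_bounded n k (c powr s) (exp_mat n V b (1/2) * exp_mat n U a ((s-1)/2))" by simp
  hence "gdet_bounded n k (c powr s) (exp_mat n V (\<lambda>i. 1/2 * b i) 1 * exp_mat n U (\<lambda>i. (s-1)/2 * a i) 1)"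
    by (simp only: exp_mat_scale mult_1)
  note bound = araki[OF U V k _ this]
  define p where "p = (\<lambda>i. (s-1)/2 * a i)"
  \<comment> \<open>A test frame independent of \<open>x\<close>: the first \<open>k\<close>
    eigenvectors of the generator that will appear as derivative.\<close>
  define E where "E = X * first_cols n k"
  have E: "E \<in> carrier_mat n k" and [simp]: "dim_row E = n" "dim_col E = k" by (simp_all add: E_def)
  have EE: "adj E * E = 1\<^sub>m k"
    unfolding E_def using k by (simp add: adj_mult mat_assoc cancel_mult[of "adj X" X n] adj_first_cols_mult)
  define M where "M = (\<lambda>x. adj E * ((exp_mat n U p x * (exp_mat n V b x * exp_mat n U p x)) * E))"
  define N' where "N' = spec_mat n U p + (spec_mat n V b + spec_mat n U p)"
  have N'c: "N' \<in> carrier_mat n n" by (simp add: N'_def)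
  have "mat_deriv n n (\<lambda>x. exp_mat n U p x * (exp_mat n V b x * exp_mat n U p x)) N'"
    using mat_deriv_mult[OF mat_deriv_exp_mat[OF U, of p] mat_deriv_mult[OF mat_deriv_exp_mat[OF V, of b] mat_deriv_exp_mat[OF U, of p]]]
      U V by (simp add: exp_mat_0 N'_def)
  note mat_deriv_mult[OF mat_deriv_const mat_deriv_mult[OF this mat_deriv_const[OF E]], of "adj E" k]
  hence M': "mat_deriv k k M (adj E * (N' * E))"
    using U V N'c E by (simp add: M_def exp_mat_0)
  \<comment> \<open>The two copies of \<open>p\<close> add up to \<open>(s - 1) * a\<close>, and
    \<open>s - 1 = (1 - t) / t\<close>.\<close>
  have "N' = complex_of_real (1 / t) \<cdot>\<^sub>m spec_mat n X l"
  proof -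
    have "N' = complex_of_real (1 / t) \<cdot>\<^sub>m (complex_of_real (1 - t) \<cdot>\<^sub>m spec_mat n U a + complex_of_real t \<cdot>\<^sub>m spec_mat n V b)"
      unfolding N'_def p_def spec_smult[OF unitaryD(1)[OF U], symmetric] s_def using t
      by (intro eq_matI) (auto simp: field_simps)
    thus ?thesis unfolding L .
  qed
  hence "N' = spec_mat n X (\<lambda>i. 1 / t * l i)" by (simp only: spec_smult[OF unitaryD(1)[OF X]])
  hence "adj E * (N' * E) = adj (first_cols n k) * (adj X * (spec_mat n X (\<lambda>i. 1 / t * l i) * X)) * first_cols n k"
    unfolding E_def by (simp add: adj_mult mat_assoc)
  also have "\<dots> = rdiag k (\<lambda>i. 1 / t * l i)"
    unfolding spec_conj[OF X] using k by (simp add: mat_assoc first_cols_conj)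
  finally have tr: "(\<Sum>i<k. (adj E * (N' * E)) $$ (i,i)) = of_real (\<Sum>i<k. 1 / t * l i)" by simp
  have "Re (\<Sum>i<k. (adj E * (N' * E)) $$ (i,i)) \<le> ln (c powr s)"
  proof (rule det_deriv_le[OF M'])
    show "M 0 = 1\<^sub>m k" using U V E by (simp add: M_def exp_mat_0 EE)
    show "0 < c powr s" using c by simp
    fix x :: real assume x: "0 \<le> x" "x \<le> 1"
    define F where "F = exp_mat n V (\<lambda>i. 1/2 * b i) x * exp_mat n U p x"
    have "F \<in> carrier_mat n n" and [simp]: "dim_row F = n" "dim_col F = n" by (simp_all add: F_def)
    have "adj F * F = exp_mat n U p x * (exp_mat n V b x * exp_mat n U p x)"
      unfolding F_def exp_mat_scale using V by (simp add: adj_mult mat_assoc exp_mat_mult_left)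
    hence "M x = adj E * (adj F * F * E)" unfolding M_def by simp
    also have "\<dots> = adj (F * E) * (F * E)" by (simp add: adj_mult mat_assoc)
    finally have "Re (det (M x)) = gdet (F * E)" by (simp add: gdet_def)
    also have "\<dots> \<le> (c powr s) powr x * gdet E"
      using bound[OF _ x] c E unfolding F_def p_def gdet_bounded_def by simp
    also have "gdet E = 1" by (simp add: gdet_def EE)
    finally show "Re (det (M x)) \<le> (c powr s) powr x" by simp
  qed
  hence "1 / t * (\<Sum>i<k. l i) \<le> s * ln c"
    unfolding tr sum_distrib_left[symmetric] using c by (simp add: ln_powr)
  hence "(\<Sum>i<k. l i) \<le> ln c" using t by (simp add: s_def field_simps)
  also have "ln c = (\<Sum>i<k. ln (g i))"
  proof -
    have "0 < g i \<and> g i \<noteq> 0" if "i < k" for i using g(2)[of i] that k by auto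
    thus ?thesis unfolding c_def by (subst ln_prod) auto
  qed
  finally show ?thesis .
qed

text \<open>With \<open>Z = B\<^bsup>-1/2\<^esup> A\<^bsup>1/2\<^esup>\<close> the polar part \<open>W' = Z W y\<^bsup>1/2\<^esup>\<close> diagonalises
  \<open>B\<^bsup>-1/2\<^esup> A B\<^bsup>-1/2\<^esup>\<close>; the conclusion is \<open>A #\<^sub>t B = B #\<^bsub>1-t\<^esub> A\<close>.\<close>

lemma gmean_swap:
  assumes U: "unitary n U" and V: "unitary n V" and W: "unitary n W"
    and y: "\<And>i. i < n \<Longrightarrow> 0 < y i"
    and Y: "exp_mat n U a (-1/2) * (exp_mat n V b 1 * exp_mat n U a (-1/2)) = spec_mat n W y"
  shows "\<exists>W'. unitary n W' \<and> exp_mat n V b (-1/2) * (exp_mat n U a 1 * exp_mat n V b (-1/2)) = spec_mat n W' (\<lambda>i. 1 / y i) \<and>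
    exp_mat n V b (1/2) * (spec_mat n W' (\<lambda>i. (1 / y i) powr (1 - t)) * exp_mat n V b (1/2)) =
    exp_mat n U a (1/2) * (spec_mat n W (\<lambda>i. y i powr t) * exp_mat n U a (1/2))"
proof -
  note [simp] = unitaryD[OF U] unitaryD[OF V] unitaryD[OF W]
  define Z where "Z = exp_mat n V b (-1/2) * exp_mat n U a (1/2)"
  have [simp]: "Z \<in> carrier_mat n n" "dim_row Z = n" "dim_col Z = n" by (simp_all add: Z_def)
  have adjZ: "adj Z = exp_mat n U a (1/2) * exp_mat n V b (-1/2)" by (simp add: Z_def adj_mult)
  define W' where "W' = Z * (W * rdiag n (\<lambda>i. sqrt (y i)))"
  have [simp]: "W' \<in> carrier_mat n n" "dim_row W' = n" "dim_col W' = n" by (simp_all add: W'_def)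
  \<comment> \<open>The two square roots in \<open>W'\<close> meet around \<open>d\<close> and
    contribute the factor \<open>y i\<close>.\<close>
  have sp: "spec_mat n W' d = Z * (spec_mat n W (\<lambda>i. y i * d i) * adj Z)" for d
  proof -
    have "rdiag n (\<lambda>i. sqrt (y i)) * (rdiag n d * (rdiag n (\<lambda>i. sqrt (y i)) * (adj W * adj Z)))
        = rdiag n (\<lambda>i. sqrt (y i)) * rdiag n d * rdiag n (\<lambda>i. sqrt (y i)) * (adj W * adj Z)"
      by (simp add: mat_assoc)
    also have "rdiag n (\<lambda>i. sqrt (y i)) * rdiag n d * rdiag n (\<lambda>i. sqrt (y i)) = rdiag n (\<lambda>i. y i * d i)"
      unfolding rdiag_mult
    proof (rule rdiag_cong)
      fix i assume "i < n"
      thus "sqrt (y i) * d i * sqrt (y i) = y i * d i" using y[of i] by (simp add: mult.commute mult.left_commute)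
    qed
    finally show ?thesis unfolding spec_mat_def W'_def by (simp add: adj_mult mat_assoc)
  qed
  \<comment> \<open>With \<open>d = 1\<close> this is Z Y \<open>adj Z\<close>, where the powers of
    A and B cancel.\<close>
  have "W' * adj W' = spec_mat n W' (\<lambda>_. 1)" by (simp add: spec_mat_def rdiag_one)
  also have "\<dots> = Z * (spec_mat n W y * adj Z)" unfolding sp by simp
  also have "\<dots> = 1\<^sub>m n"
    unfolding Y[symmetric] adjZ unfolding Z_def using U V
    by (simp add: mat_assoc exp_mat_mult exp_mat_mult_left exp_mat_0)
  finally have "unitary n W'"
    using mat_mult_left_right_inverse[of W' n "adj W'"] by (intro unitaryI) auto
  moreover have "spec_mat n W' (\<lambda>i. 1 / y i) = Z * (spec_mat n W (\<lambda>_. 1) * adj Z)"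
  proof -
    have "spec_mat n W (\<lambda>i. y i * (1 / y i)) = spec_mat n W (\<lambda>_. 1)"
    proof (rule spec_cong)
      fix i assume "i < n" thus "y i * (1 / y i) = 1" using y[of i] by simp
    qed
    thus ?thesis unfolding sp by simp
  qed
  hence "exp_mat n V b (-1/2) * (exp_mat n U a 1 * exp_mat n V b (-1/2)) = spec_mat n W' (\<lambda>i. 1 / y i)"
    unfolding adjZ unfolding Z_def using U V W
    by (simp add: spec_one mat_assoc exp_mat_mult_left)
  \<comment> \<open>The extra factor \<open>y i\<close> turns exponent \<open>t - 1\<close> into
    \<open>t\<close>; the outer B^{1/2} then cancel the B^{-1/2} contained in \<open>Z\<close> and
    \<open>adj Z\<close>.\<close>
  moreover have "spec_mat n W' (\<lambda>i. (1 / y i) powr (1 - t)) = Z * (spec_mat n W (\<lambda>i. y i powr t) * adj Z)"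
  proof -
    have "spec_mat n W (\<lambda>i. y i * (1 / y i) powr (1 - t)) = spec_mat n W (\<lambda>i. y i powr t)"
    proof (rule spec_cong)
      fix i assume "i < n"
      hence "0 < y i" by (rule y)
      thus "y i * (1 / y i) powr (1 - t) = y i powr t"
        by (simp add: powr_divide powr_diff)
    qed
    thus ?thesis unfolding sp by simp
  qed
  hence "exp_mat n V b (1/2) * (spec_mat n W' (\<lambda>i. (1 / y i) powr (1 - t)) * exp_mat n V b (1/2)) =
    exp_mat n U a (1/2) * (spec_mat n W (\<lambda>i. y i powr t) * exp_mat n U a (1/2))"
    unfolding adjZ unfolding Z_def using U V W
    by (simp add: mat_assoc exp_mat_mult_left exp_mat_mult exp_mat_0)
  ultimately show ?thesis by blast
qed

section \<open>Weak majorization and unitarily invariant norms\<close>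

text \<open>Each transfer moves mass from a coordinate where \<open>b\<close> exceeds \<open>a\<close> to the first one where it falls short,
  making one more coordinate agree; \<open>b\<close> need not stay sorted.\<close>

lemma weak_majorization_mono:
  fixes \<Phi> :: "(nat \<Rightarrow> real) \<Rightarrow> real"
  assumes cong: "\<And>a b. (\<And>i. i < n \<Longrightarrow> a i = b i) \<Longrightarrow> \<Phi> a = \<Phi> b"
    and mono: "\<And>b i x. i < n \<Longrightarrow> x \<le> b i \<Longrightarrow> \<Phi> (b(i := x)) \<le> \<Phi> b"
    and transfer: "\<And>b i j e. i < n \<Longrightarrow> j < n \<Longrightarrow> i \<noteq> j \<Longrightarrow> 0 \<le> e \<Longrightarrow> b j + e \<le> b i - e \<Longrightarrow>
        \<Phi> (b(i := b i - e, j := b j + e)) \<le> \<Phi> b"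
    and a: "decr_below n a" and maj: "\<And>k. k \<le> n \<Longrightarrow> (\<Sum>i<k. a i) \<le> (\<Sum>i<k. b i)"
  shows "\<Phi> a \<le> \<Phi> b"
  using maj
proof (induction "card {i. i < n \<and> a i \<noteq> b i}" arbitrary: b rule: less_induct)
  case less
  show ?case
  proof (cases "\<exists>j<n. b j < a j")
    case False
    \<comment> \<open>When no entry of \<open>b\<close> falls short, \<open>b\<close> is lowered to
      \<open>a\<close> one coordinate at a time by \<open>mono\<close>.\<close>
    hence le: "a i \<le> b i" if "i < n" for i using that by force
    show ?thesis
    proof (cases "\<exists>i<n. a i \<noteq> b i")
      case False
      hence "\<Phi> a = \<Phi> b" by (intro cong) auto
      thus ?thesis by simp
    next
      case True
      then obtain i where i: "i < n" "a i \<noteq> b i" by blast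
      have "{j. j < n \<and> a j \<noteq> (b(i := a i)) j} \<subset> {j. j < n \<and> a j \<noteq> b j}" using i by auto
      hence "card {j. j < n \<and> a j \<noteq> (b(i := a i)) j} < card {j. j < n \<and> a j \<noteq> b j}"
        by (intro psubset_card_mono) auto
      moreover have "(\<Sum>j<k. a j) \<le> (\<Sum>j<k. (b(i := a i)) j)" if "k \<le> n" for k
        using le that by (intro sum_mono) auto
      ultimately have "\<Phi> a \<le> \<Phi> (b(i := a i))" by (rule less.hyps)
      also have "\<dots> \<le> \<Phi> b" using i le by (intro mono) auto
      finally show ?thesis .
    qed
  next
    case True
    define j where "j = (LEAST j. j < n \<and> b j < a j)"
    have j: "j < n" "b j < a j" using LeastI_ex[OF True] by (simp_all add: j_def)
    have before: "a l \<le> b l" if "l < j" for l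
      using not_less_Least[of l "\<lambda>j. j < n \<and> b j < a j"] that j by (auto simp: j_def)
    \<comment> \<open>Without an earlier surplus, the shortfall at \<open>j\<close> would violate
      the partial sum inequality for \<open>Suc j\<close>.\<close>
    have "\<exists>i<j. a i < b i"
    proof (rule ccontr)
      assume "\<not> ?thesis"
      hence "(\<Sum>l<j. b l) \<le> (\<Sum>l<j. a l)" by (intro sum_mono) force
      hence "(\<Sum>l<Suc j. b l) < (\<Sum>l<Suc j. a l)" using j by simp
      thus False using less.prems[of "Suc j"] j by simp
    qed
    then obtain i where i: "i < j" "a i < b i" by blast
    \<comment> \<open>The smaller of surplus and deficit: one of the two coordinates becomes exact
      and neither overshoots.\<close>
    define e where "e = min (b i - a i) (a j - b j)"
    have e: "0 < e" "e \<le> b i - a i" "e \<le> a j - b j" using i j by (auto simp: e_def)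
    \<comment> \<open>Sortedness of \<open>a\<close> gives
      \<open>b j + e <= a j <= a i <= b i - e\<close>, the side condition of
      \<open>transfer\<close>.\<close>
    have aij: "a j \<le> a i" using decr_belowD[OF a, of i j] i j by simp
    define b' where "b' = b(i := b i - e, j := b j + e)"
    have "{l. l < n \<and> a l \<noteq> b' l} \<subset> {l. l < n \<and> a l \<noteq> b l}"
    proof (rule psubsetI)
      show "{l. l < n \<and> a l \<noteq> b' l} \<subseteq> {l. l < n \<and> a l \<noteq> b l}"
        using i j by (auto simp: b'_def split: if_splits)
      have "a i = b' i \<or> a j = b' j" using i by (auto simp: b'_def e_def min_def)
      hence "i \<notin> {l. l < n \<and> a l \<noteq> b' l} \<or> j \<notin> {l. l < n \<and> a l \<noteq> b' l}" by simp
      moreover have "i \<in> {l. l < n \<and> a l \<noteq> b l}" "j \<in> {l. l < n \<and> a l \<noteq> b l}"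
        using i j by simp_all
      ultimately show "{l. l < n \<and> a l \<noteq> b' l} \<noteq> {l. l < n \<and> a l \<noteq> b l}" by blast
    qed
    hence "card {l. l < n \<and> a l \<noteq> b' l} < card {l. l < n \<and> a l \<noteq> b l}"
      by (intro psubset_card_mono) auto
    \<comment> \<open>Up to \<open>j\<close> the new entries still dominate those of
      \<open>a\<close> termwise; beyond \<open>j\<close> the transfer lies inside the partial sum
      and leaves it unchanged.\<close>
    moreover have "(\<Sum>l<k. a l) \<le> (\<Sum>l<k. b' l)" if k: "k \<le> n" for k
    proof (cases "k \<le> j")
      case True
      have "a l \<le> b' l" if "l < k" for l
        using that True before[of l] e i by (auto simp: b'_def)
      thus ?thesis by (intro sum_mono) auto
    next
      case False
      have "b' l = b l + ((if l = j then e else 0) - (if l = i then e else 0))" for l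
        using i by (auto simp: b'_def)
      hence "(\<Sum>l<k. b' l) = (\<Sum>l<k. b l)" using False i by (simp add: sum.distrib sum_subtractf)
      thus ?thesis using less.prems[OF k] by simp
    qed
    ultimately have "\<Phi> a \<le> \<Phi> b'" by (rule less.hyps)
    also have "\<dots> \<le> \<Phi> b"
      unfolding b'_def using i j e aij by (intro transfer) auto
    finally show ?thesis .
  qed
qed

text \<open>Averages the tangent line inequality at the point \<open>m\<close>, where the linear
  terms cancel.\<close>

lemma exp_convex_comb:
  fixes u v c :: real
  assumes "0 \<le> c" "c \<le> 1"
  shows "exp ((1 - c) * u + c * v) \<le> (1 - c) * exp u + c * exp v"
proof -
  define m where "m = (1 - c) * u + c * v"
  have *: "exp m * (1 + (x - m)) \<le> exp x" for x
  proof -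
    have "exp m * (1 + (x - m)) \<le> exp m * exp (x - m)" by (intro mult_left_mono exp_ge_add_one_self) auto
    thus ?thesis by (simp add: exp_add[symmetric])
  qed
  have "(1 - c) * (exp m * (1 + (u - m))) + c * (exp m * (1 + (v - m))) \<le> (1 - c) * exp u + c * exp v"
    using assms * by (intro add_mono mult_left_mono) auto
  also have "(1 - c) * (exp m * (1 + (u - m))) + c * (exp m * (1 + (v - m))) = exp m * (1 + ((1 - c) * u + c * v - m))"
    by (simp add: algebra_simps)
  finally show ?thesis by (simp add: m_def)
qed

section \<open>Unitarily invariant norms of diagonal matrices\<close>

locale uinorm =
  fixes n :: nat and N :: "complex mat \<Rightarrow> real"
  assumes N: "unitarily_invariant_norm n N"
begin

lemma N_smult: "A \<in> carrier_mat n n \<Longrightarrow> N (c \<cdot>\<^sub>m A) = cmod c * N A"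
  and N_add: "A \<in> carrier_mat n n \<Longrightarrow> B \<in> carrier_mat n n \<Longrightarrow> N (A + B) \<le> N A + N B"
  and N_unitary: "A \<in> carrier_mat n n \<Longrightarrow> unitary n U \<Longrightarrow> unitary n V \<Longrightarrow> N (U * A * V) = N A"
  using N unfolding unitarily_invariant_norm_def by blast+

lemma N_spec: "unitary n U \<Longrightarrow> N (spec_mat n U d) = N (rdiag n d)"
  unfolding spec_mat_def by (rule N_unitary) (auto intro: unitary_adj)

lemma N_rdiag_combine:
  assumes "0 \<le> x" "0 \<le> y"
  shows "N (rdiag n (\<lambda>i. x * p i + y * q i)) \<le> x * N (rdiag n p) + y * N (rdiag n q)"
proof -
  have "rdiag n (\<lambda>i. x * p i + y * q i) = complex_of_real x \<cdot>\<^sub>m rdiag n p + complex_of_real y \<cdot>\<^sub>m rdiag n q"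
    by (simp add: rdiag_smult rdiag_add)
  also have "N \<dots> \<le> N (complex_of_real x \<cdot>\<^sub>m rdiag n p) + N (complex_of_real y \<cdot>\<^sub>m rdiag n q)"
    by (rule N_add) auto
  finally show ?thesis using assms by (simp add: N_smult)
qed

text \<open>Shrinking one entry averages the diagonal matrix with its reflection in that coordinate.\<close>

lemma N_rdiag_shrink:
  assumes x: "0 \<le> x" "x \<le> q i"
  shows "N (rdiag n (q(i := x))) \<le> N (rdiag n q)"
proof (cases "q i = 0")
  case True
  hence "q(i := x) = q" using x by auto
  thus ?thesis by simp
next
  case False
  define S where "S = rdiag n (\<lambda>j. if j = i then - 1 else 1)"
  have S: "unitary n S"
  proof (rule unitaryI)
    have "adj S * S = rdiag n (\<lambda>_. 1)" unfolding S_def adj_rdiag rdiag_mult by (rule rdiag_cong) auto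
    thus "adj S * S = 1\<^sub>m n" by (simp add: rdiag_one)
  qed (simp add: S_def)
  \<comment> \<open>Weights \<open>(1 + z) / 2\<close> and \<open>(1 - z) / 2\<close> on
    \<open>q i\<close> and \<open>- q i\<close> average to \<open>z * q i = x\<close>.\<close>
  define z where "z = x / q i"
  have z: "0 \<le> z" "z \<le> 1" "z * q i = x" using x False by (auto simp: z_def divide_le_eq_1)
  have "S * rdiag n q = rdiag n (q(i := - q i))"
    unfolding S_def rdiag_mult by (rule rdiag_cong) auto
  moreover have "N (S * rdiag n q) = N (rdiag n q)"
    using N_unitary[of "rdiag n q" S "1\<^sub>m n"] S by (simp add: S_def)
  ultimately have refl: "N (rdiag n (q(i := - q i))) = N (rdiag n q)" by simp
  have "rdiag n (q(i := x)) = rdiag n (\<lambda>j. (1 + z) / 2 * q j + (1 - z) / 2 * (q(i := - q i)) j)"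
    using z by (intro rdiag_cong) (auto simp: field_simps)
  also have "N \<dots> \<le> (1 + z) / 2 * N (rdiag n q) + (1 - z) / 2 * N (rdiag n (q(i := - q i)))"
    using z by (intro N_rdiag_combine) auto
  also have "\<dots> = N (rdiag n q)" unfolding refl by (simp add: field_simps)
  finally show ?thesis .
qed

lemma N_rdiag_mono:
  assumes pq: "\<And>i. i < n \<Longrightarrow> 0 \<le> p i" "\<And>i. i < n \<Longrightarrow> p i \<le> q i"
  shows "N (rdiag n p) \<le> N (rdiag n q)"
proof -
  have "N (rdiag n (\<lambda>i. if i < m then p i else q i)) \<le> N (rdiag n q)" if "m \<le> n" for m
    using that
  proof (induction m)
    case (Suc m)
    have eq: "(\<lambda>i. if i < Suc m then p i else q i) = (\<lambda>i. if i < m then p i else q i)(m := p m)" by auto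
    have "N (rdiag n (\<lambda>i. if i < Suc m then p i else q i)) \<le> N (rdiag n (\<lambda>i. if i < m then p i else q i))"
      unfolding eq using Suc.prems pq by (intro N_rdiag_shrink) auto
    thus ?case using Suc by simp
  qed simp
  from this[of n] show ?thesis by (simp cong: rdiag_cong)
qed

text \<open>A transfer replaces the exponents by a convex combination of themselves and a transposed
  copy. Convexity of \<open>exp\<close> moves the combination outside, and the norm does not see the
  transposition.\<close>

lemma N_exp_majorization:
  assumes "decr_below n a" "\<And>k. k \<le> n \<Longrightarrow> (\<Sum>i<k. a i) \<le> (\<Sum>i<k. b i)"
  shows "N (rdiag n (\<lambda>i. exp (a i))) \<le> N (rdiag n (\<lambda>i. exp (b i)))"
proof (rule weak_majorization_mono[where \<Phi> = "\<lambda>a. N (rdiag n (\<lambda>i. exp (a i)))", OF _ _ _ assms])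
  fix a b :: "nat \<Rightarrow> real" assume "\<And>i. i < n \<Longrightarrow> a i = b i"
  thus "N (rdiag n (\<lambda>i. exp (a i))) = N (rdiag n (\<lambda>i. exp (b i)))" by (simp cong: rdiag_cong)
next
  fix b :: "nat \<Rightarrow> real" and i x assume "i < n" "x \<le> b i"
  thus "N (rdiag n (\<lambda>j. exp ((b(i := x)) j))) \<le> N (rdiag n (\<lambda>j. exp (b j)))"
    by (intro N_rdiag_mono) auto
next
  fix b :: "nat \<Rightarrow> real" and i j e
  assume ij: "i < n" "j < n" "i \<noteq> j" and e: "0 \<le> e" "b j + e \<le> b i - e"
  show "N (rdiag n (\<lambda>l. exp ((b(i := b i - e, j := b j + e)) l))) \<le> N (rdiag n (\<lambda>l. exp (b l)))"
  proof (cases "e = 0")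
    case True
    thus ?thesis by simp
  next
    case False
    define p where "p = (\<lambda>l. if l = i then j else if l = j then i else l)"
    have p: "bij_betw p {..<n} {..<n}"
      by (rule bij_betw_byWitness[of _ p]) (use ij in \<open>auto simp: p_def\<close>)
    \<comment> \<open>Chosen so that mixing in the swapped exponents with weight \<open>c\<close>
      moves exactly \<open>e\<close>. For \<open>e > 0\<close> the gap \<open>b i - b j\<close> is
      at least \<open>2 * e\<close>; for \<open>e = 0\<close> it may vanish, hence the separate
      case.\<close>
    define c where "c = e / (b i - b j)"
    have c: "0 \<le> c" "c \<le> 1" "c * (b i - b j) = e" using e False by (auto simp: c_def divide_le_eq_1)
    have "N (rdiag n (\<lambda>l. exp ((b(i := b i - e, j := b j + e)) l)))
        \<le> N (rdiag n (\<lambda>l. (1 - c) * exp (b l) + c * exp (b (p l))))"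
    proof (rule N_rdiag_mono)
      fix l
      have "(b(i := b i - e, j := b j + e)) l = (1 - c) * b l + c * b (p l)"
        using c(3) ij by (auto simp: p_def algebra_simps)
      thus "exp ((b(i := b i - e, j := b j + e)) l) \<le> (1 - c) * exp (b l) + c * exp (b (p l))"
        using exp_convex_comb[OF c(1,2)] by simp
    qed simp
    also have "\<dots> \<le> (1 - c) * N (rdiag n (\<lambda>l. exp (b l))) + c * N (rdiag n (\<lambda>l. exp (b (p l))))"
      using c by (intro N_rdiag_combine) auto
    also have "N (rdiag n (\<lambda>l. exp (b (p l)))) = N (rdiag n (\<lambda>l. exp (b l)))"
      using perm_mat_conj(1)[OF p] perm_mat_conj(2)[OF p, of "\<lambda>l. exp (b l)"] N_spec[of "perm_mat n p" "(\<lambda>l. exp (b l)) \<circ> p"]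
      by (simp add: comp_def)
    also have "(1 - c) * N (rdiag n (\<lambda>l. exp (b l))) + c * N (rdiag n (\<lambda>l. exp (b l))) = N (rdiag n (\<lambda>l. exp (b l)))"
      by (simp add: algebra_simps)
    finally show ?thesis .
  qed
qed

end

section \<open>The norm inequality\<close>

lemma hermitian_smult_add:
  assumes "hermitian n H" "hermitian n K"
  shows "hermitian n (complex_of_real a \<cdot>\<^sub>m H + complex_of_real b \<cdot>\<^sub>m K)"
  using assms carrier_matD[of H n n] carrier_matD[of K n n]
  by (simp add: hermitian_def adj_add adj_smult)

lemma mexp_smult_spec:
  assumes "unitary n U"
  shows "mexp (complex_of_real r \<cdot>\<^sub>m spec_mat n U h) = exp_mat n U (\<lambda>i. r * h i) 1"
  unfolding spec_smult[OF unitaryD(1)[OF assms]] mexp_def mat_fun_spec[OF assms] exp_mat_def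
  by (rule spec_cong) simp

lemma mpow_exp_mat:
  assumes "unitary n U"
  shows "mpow (exp_mat n U h 1) p = exp_mat n U h p"
  unfolding exp_mat_def mpow_def mat_fun_spec[OF assms] by (rule spec_cong) (simp add: powr_def mult.commute)

lemma mpow_spec: "unitary n U \<Longrightarrow> mpow (spec_mat n U d) p = spec_mat n U (\<lambda>i. d i powr p)"
  unfolding mpow_def by (simp add: mat_fun_spec comp_def)

theorem theorem1:
  fixes n :: nat and H K :: "complex mat" and r t :: real and N :: "complex mat \<Rightarrow> real"
  assumes "hermitian n H" and "hermitian n K" and "r > 0"
    and "t \<le> 0 \<or> t \<ge> 1"
    and "unitarily_invariant_norm n N"
  shows "N (mexp (complex_of_real (1 - t) \<cdot>\<^sub>m H + complex_of_real t \<cdot>\<^sub>m K))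
           \<le> N (mpow (gmean (mexp (complex_of_real r \<cdot>\<^sub>m H)) t (mexp (complex_of_real r \<cdot>\<^sub>m K))) (1/r))"
proof -
  interpret uinorm n N by unfold_locales fact
  obtain U h where U: "unitary n U" and H: "H = spec_mat n U h" using spectral_theorem[OF assms(1)] by blast
  obtain V v where V: "unitary n V" and K: "K = spec_mat n V v" using spectral_theorem[OF assms(2)] by blast
  note [simp] = unitaryD[OF U] unitaryD[OF V]
  define a where "a = (\<lambda>i. r * h i)"
  define b where "b = (\<lambda>i. r * v i)"
  have A: "mexp (complex_of_real r \<cdot>\<^sub>m H) = exp_mat n U a 1" unfolding H a_def by (rule mexp_smult_spec[OF U])
  have B: "mexp (complex_of_real r \<cdot>\<^sub>m K) = exp_mat n V b 1" unfolding K b_def by (rule mexp_smult_spec[OF V])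
  \<comment> \<open>A square root factor of A^{-1/2} B A^{-1/2}; its invertibility makes all
    eigenvalues \<open>y i\<close> positive.\<close>
  define Z where "Z = exp_mat n V b (1/2) * exp_mat n U a (-1/2)"
  have Z: "Z \<in> carrier_mat n n" by (simp add: Z_def)
  have "exp_mat n U a (1/2) * exp_mat n V b (-1/2) * Z = 1\<^sub>m n"
    using U V by (simp add: Z_def mat_assoc exp_mat_mult exp_mat_mult_left exp_mat_0)
  then obtain W y where W: "unitary n W" and y: "\<And>i. i < n \<Longrightarrow> 0 < y i" and ZZ: "adj Z * Z = spec_mat n W y"
    using gram_spec_pos[OF Z, of "exp_mat n U a (1/2) * exp_mat n V b (-1/2)"] by auto
  note [simp] = unitaryD[OF W]
  have Y: "exp_mat n U a (-1/2) * (exp_mat n V b 1 * exp_mat n U a (-1/2)) = spec_mat n W y"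
    unfolding ZZ[symmetric] Z_def using V by (simp add: adj_mult mat_assoc exp_mat_mult_left)
  define G where "G = exp_mat n U a (1/2) * (spec_mat n W (\<lambda>i. y i powr t) * exp_mat n U a (1/2))"
  have gm: "gmean (mexp (complex_of_real r \<cdot>\<^sub>m H)) t (mexp (complex_of_real r \<cdot>\<^sub>m K)) = G"
    unfolding gmean_def A B mpow_exp_mat[OF U] G_def using Y
    by (simp add: mat_assoc mpow_spec[OF W])
  let ?R = "exp_mat n W (\<lambda>i. ln (y i))"
  have yR: "spec_mat n W (\<lambda>i. y i powr p) = ?R p" for p using y by (rule spec_powr_eq_exp_mat)
  \<comment> \<open>The mean is the Gram matrix of an invertible product, hence has positive
    eigenvalues for every real \<open>t\<close>.\<close>
  have "?R (t/2) * exp_mat n U a (1/2) \<in> carrier_mat n n"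
       "exp_mat n U a (-1/2) * ?R (-t/2) \<in> carrier_mat n n"
       "exp_mat n U a (-1/2) * ?R (-t/2) * (?R (t/2) * exp_mat n U a (1/2)) = 1\<^sub>m n"
    using U W by (simp_all add: mat_assoc exp_mat_mult exp_mat_mult_left exp_mat_0)
  moreover have "adj (?R (t/2) * exp_mat n U a (1/2)) * (?R (t/2) * exp_mat n U a (1/2)) = G"
    unfolding G_def yR using W by (simp add: adj_mult mat_assoc exp_mat_mult_left)
  ultimately obtain C g where C: "unitary n C" and g: "decr_below n g" "\<And>i. i < n \<Longrightarrow> 0 < g i" and GC: "G = spec_mat n C g"
    using gram_spec_pos[of "?R (t/2) * exp_mat n U a (1/2)" n "exp_mat n U a (-1/2) * ?R (-t/2)"] by metis
  let ?L = "complex_of_real (1 - t) \<cdot>\<^sub>m H + complex_of_real t \<cdot>\<^sub>m K"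
  obtain X l where X: "unitary n X" and l: "decr_below n l" and L: "?L = spec_mat n X l"
    using spectral_theorem_sorted[OF hermitian_smult_add[OF assms(1,2)]] by blast
  note [simp] = unitaryD[OF X] unitaryD[OF C]
  have rL: "complex_of_real (1 - t) \<cdot>\<^sub>m spec_mat n U a + complex_of_real t \<cdot>\<^sub>m spec_mat n V b = spec_mat n X (\<lambda>i. r * l i)"
  proof -
    have "complex_of_real (1 - t) \<cdot>\<^sub>m spec_mat n U a + complex_of_real t \<cdot>\<^sub>m spec_mat n V b = complex_of_real r \<cdot>\<^sub>m ?L"
      unfolding a_def b_def spec_smult[OF unitaryD(1)[OF U], symmetric] spec_smult[OF unitaryD(1)[OF V], symmetric] H K
      by (intro eq_matI) (auto simp: algebra_simps)
    thus ?thesis unfolding L spec_smult[OF unitaryD(1)[OF X]] .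
  qed
  have maj: "(\<Sum>i<k. r * l i) \<le> (\<Sum>i<k. ln (g i))" if k: "k \<le> n" for k
  proof (cases "1 \<le> t")
    case True
    show ?thesis
      by (rule log_majorization[OF U V W C X True k y Y GC[unfolded G_def] g rL])
  next
    case False
    \<comment> \<open>For \<open>t <= 0\<close> the two matrices change places: the weight becomes
      \<open>1 - t\<close> and the mean \<open>G\<close> stays the same, so the eigenvalues
      \<open>g\<close> serve both cases.\<close>
    hence t: "1 \<le> 1 - t" using assms(4) by simp
    obtain W' where W': "unitary n W'"
      and Y': "exp_mat n V b (-1/2) * (exp_mat n U a 1 * exp_mat n V b (-1/2)) = spec_mat n W' (\<lambda>i. 1 / y i)"
      and G': "exp_mat n V b (1/2) * (spec_mat n W' (\<lambda>i. (1 / y i) powr (1 - t)) * exp_mat n V b (1/2)) = G"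
      using gmean_swap[OF U V W y Y, of t] unfolding G_def by blast
    have "complex_of_real (1 - (1 - t)) \<cdot>\<^sub>m spec_mat n V b + complex_of_real (1 - t) \<cdot>\<^sub>m spec_mat n U a = spec_mat n X (\<lambda>i. r * l i)"
      unfolding rL[symmetric] by (intro eq_matI) auto
    with y show ?thesis
      by (intro log_majorization[OF V U W' C X t k _ Y' G'[unfolded GC] g]) auto
  qed
  have "N (mexp ?L) = N (rdiag n (\<lambda>i. exp (l i)))"
    unfolding L mexp_def mat_fun_spec[OF X] N_spec[OF X] by (simp add: comp_def)
  \<comment> \<open>Dividing the majorization by \<open>r\<close> bounds the partial sums of
    \<open>l\<close> by those of the logarithms of the eigenvalues of \<open>G\<close> to the power
    \<open>1 / r\<close>.\<close>
  also have "\<dots> \<le> N (rdiag n (\<lambda>i. exp (1 / r * ln (g i))))"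
  proof (rule N_exp_majorization[OF l])
    fix k assume "k \<le> n"
    from maj[OF this] show "(\<Sum>i<k. l i) \<le> (\<Sum>i<k. 1 / r * ln (g i))"
      using assms(3) by (simp add: sum_distrib_left[symmetric] sum_divide_distrib[symmetric] field_simps)
  qed
  also have "rdiag n (\<lambda>i. exp (1 / r * ln (g i))) = rdiag n (\<lambda>i. g i powr (1 / r))"
  proof (rule rdiag_cong)
    fix i assume "i < n"
    thus "exp (1 / r * ln (g i)) = g i powr (1 / r)" using g(2)[of i] by (simp add: powr_def)
  qed
  also have "N \<dots> = N (mpow G (1/r))"
    unfolding GC mpow_spec[OF C] N_spec[OF C] ..
  finally show ?thesis unfolding gm .
qed

end
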